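(* For $i\ge 1$ let $E_i=\{\xi\in\{0,1\}^{\omega} : \text{the infinite Schreier graph } \Gamma_\xi \text{ of the Basilica group has exactly } i \text{ ends}\}$. Then: (1) $E_4=\{w0^{\omega},\ w(01)^{\omega} : w\in\{0,1\}^{*}\}$; (2) $E_1=\{\alpha_1\beta_1\alpha_2\beta_2\ldots : \alpha_i,\beta_j\in\{0,1\},\ \text{both sequences } \{\alpha_i\}_{i\ge1} \text{ and } \{\beta_j\}_{j\ge1} \text{ contain infinitely many } 1\text{'s}\}$; (3) $E_2=\{0,1\}^{\omega}\setminus(E_1\sqcup E_4)$.
   Context: $\{0,1\}^*$ is the set of finite binary words (including the empty word), $\{0,1\}^\omega$ the set of right-infinite binary words; $u^\omega=uuu\ldots$. The Basilica group $B=\langle a,b\rangle$ is the group of automorphisms of the rooted binary tree generated by $a,b$ acting on finite and infinite binary words by $a(0w)=0\,b(w)$, $a(1w)=1w$, $b(0w)=1\,a(w)$, $b(1w)=0w$. For $\xi\in\{0,1\}^\omega$, the Schreier graph $\Gamma_\xi$ is the undirected multigraph whose vertex set is the orbit $B\cdot\xi$, with, for every vertex $x$ and every $s\in\{a,b\}$, one edge joining $x$ and $s(x)$ (a loop if $s(x)=x$; parallel edges are allowed). An end of an infinite graph is an equivalence class of rays (infinite sequences of distinct, consecutively adjacent vertices), two rays being equivalent if for every finite vertex set $S$ both have a tail in the same connected component of the complement of $S$. *)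

theory Defs
  imports "HOL-Library.Stream" "HOL-Library.Sublist" "HOL-Library.Z2"
    "HOL-Algebra.Bij" "HOL-Algebra.Generated_Groups"
begin

section \<open>Undirected multigraphs and their ends\<close>

text \<open>\<open>endpts e\<close> is the set of the one (loop) or two endpoints of the edge \<open>e\<close>.\<close>

record ('v, 'e) multigraph =
  verts :: "'v set"
  edges :: "'e set"
  endpts :: "'e \<Rightarrow> 'v set"

definition adjacent :: "('v, 'e) multigraph \<Rightarrow> 'v \<Rightarrow> 'v \<Rightarrow> bool" where
  "adjacent G x y \<longleftrightarrow> (\<exists>e \<in> edges G. endpts G e = {x, y})"

definition is_ray :: "('v, 'e) multigraph \<Rightarrow> (nat \<Rightarrow> 'v) \<Rightarrow> bool" where
  "is_ray G r \<longleftrightarrow> inj r \<and> range r \<subseteq> verts G \<and> (\<forall>n. adjacent G (r n) (r (Suc n)))"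

definition component_avoiding :: "('v, 'e) multigraph \<Rightarrow> 'v set \<Rightarrow> 'v \<Rightarrow> 'v set" where
  "component_avoiding G S x = {y. (x, y) \<in> {(u, v). u \<notin> S \<and> v \<notin> S \<and> adjacent G u v}\<^sup>*}"

definition components_avoiding :: "('v, 'e) multigraph \<Rightarrow> 'v set \<Rightarrow> 'v set set" where
  "components_avoiding G S = component_avoiding G S ` (verts G - S)"

definition ray_equiv :: "('v, 'e) multigraph \<Rightarrow> ((nat \<Rightarrow> 'v) \<times> (nat \<Rightarrow> 'v)) set" where
  "ray_equiv G = {(r, r'). is_ray G r \<and> is_ray G r' \<and>
     (\<forall>S. finite S \<and> S \<subseteq> verts G \<longrightarrow>
        (\<exists>C \<in> components_avoiding G S. \<exists>N. \<forall>n \<ge> N. r n \<in> C \<and> r' n \<in> C))}"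

definition graph_ends :: "('v, 'e) multigraph \<Rightarrow> (nat \<Rightarrow> 'v) set set" where
  "graph_ends G = {r. is_ray G r} // ray_equiv G"

section \<open>The Basilica group\<close>

text \<open>Finite binary words are the vertices of the rooted binary tree, infinite ones its boundary.\<close>

fun gen_a gen_b :: "bit list \<Rightarrow> bit list" where
  "gen_a [] = []"
| "gen_a (x # w) = (if x = 0 then 0 # gen_b w else 1 # w)"
| "gen_b [] = []"
| "gen_b (x # w) = (if x = 0 then 1 # gen_a w else 0 # w)"

definition basilica_group :: "(bit list \<Rightarrow> bit list) set" where
  "basilica_group = generate (BijGroup UNIV) {gen_a, gen_b}"

text \<open>A tree automorphism acts on an infinite word through its finite prefixes: the \<open>n\<close>-th letter
  of the image is the \<open>n\<close>-th letter of the image of any prefix longer than \<open>n\<close>; see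
  \<open>stake_boundary_action\<close> and \<open>boundary_action_gens\<close> below.\<close>

definition boundary_action :: "(bit list \<Rightarrow> bit list) \<Rightarrow> bit stream \<Rightarrow> bit stream" where
  "boundary_action g \<xi> = smap (\<lambda>n. g (stake (Suc n) \<xi>) ! n) nats"

definition basilica_orbit :: "bit stream \<Rightarrow> bit stream set" where
  "basilica_orbit \<xi> = {boundary_action g \<xi> | g. g \<in> basilica_group}"

text \<open>The edge \<open>(x, s)\<close> joins \<open>x\<close> and \<open>s x\<close>.\<close>

definition schreier_graph ::
    "bit stream \<Rightarrow> (bit stream, bit stream \<times> (bit list \<Rightarrow> bit list)) multigraph" where
  "schreier_graph \<xi> =
     \<lparr>verts = basilica_orbit \<xi>,
      edges = basilica_orbit \<xi> \<times> {gen_a, gen_b},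
      endpts = (\<lambda>(x, s). {x, boundary_action s x})\<rparr>"

definition E :: "nat \<Rightarrow> bit stream set" where
  "E i = {\<xi>. finite (graph_ends (schreier_graph \<xi>)) \<and> card (graph_ends (schreier_graph \<xi>)) = i}"

section \<open>Well-definedness\<close>

text \<open>Automorphisms of the rooted binary tree.\<close>

definition tree_aut :: "(bit list \<Rightarrow> bit list) \<Rightarrow> bool" where
  "tree_aut g \<longleftrightarrow> bij g \<and> (\<forall>u. length (g u) = length u) \<and> (\<forall>u v. prefix u v \<longrightarrow> prefix (g u) (g v))"

lemma tree_aut_take:
  assumes "tree_aut g"
  shows "g (take n u) = take n (g u)"
proof (cases "n \<le> length u")
  case True
  have len: "length (g v) = length v" for v
    using assms unfolding tree_aut_def by simp
  have "prefix (g (take n u)) (g u)"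
    using assms take_is_prefix[of n u] unfolding tree_aut_def by simp
  then obtain z where z: "g u = g (take n u) @ z" by (rule prefixE)
  have "length (g (take n u)) = n" using True by (simp add: len)
  with z show ?thesis by (metis append_eq_conv_conj)
next
  case False
  have "length (g u) = length u" using assms unfolding tree_aut_def by simp
  with False show ?thesis by simp
qed

lemma gens_length: "length (gen_a u) = length u" "length (gen_b u) = length u"
  by (induction u and u rule: gen_a_gen_b.induct) auto

lemma gens_prefix:
  "prefix u v \<Longrightarrow> prefix (gen_a u) (gen_a v)"
  "prefix u v \<Longrightarrow> prefix (gen_b u) (gen_b v)"
proof (induction u and u arbitrary: v and v rule: gen_a_gen_b.induct)
  case (2 x w) then show ?case by (cases v) auto
next
  case (4 x w) then show ?case by (cases v) auto
qed auto

lemma gens_inj: "gen_a u = gen_a v \<Longrightarrow> u = v" "gen_b u = gen_b v \<Longrightarrow> u = v"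
proof (induction u arbitrary: v)
  case Nil
  { case 1 then show ?case by (cases v) (auto split: if_splits) }
  { case 2 then show ?case by (cases v) (auto split: if_splits) }
next
  case (Cons x w)
  { case 1 then show ?case using Cons.IH by (cases v) (auto split: if_splits) }
  { case 2 then show ?case using Cons.IH by (cases v) (auto split: if_splits) }
qed

lemma gens_surj: "\<exists>u. gen_a u = v" "\<exists>u. gen_b u = v"
proof (induction v)
  case Nil
  { case 1 show ?case by (rule exI[of _ "[]"]) simp }
  { case 2 show ?case by (rule exI[of _ "[]"]) simp }
next
  case (Cons x v)
  obtain u u' where u: "gen_a u = v" "gen_b u' = v" using Cons by blast
  { case 1 show ?case
    proof (cases "x = 0")
      case True with u have "gen_a (0 # u') = x # v" by simp
      then show ?thesis by blast
    next
      case False then have "gen_a (1 # v) = x # v" by simp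
      then show ?thesis by blast
    qed }
  { case 2 show ?case
    proof (cases "x = 0")
      case True then have "gen_b (1 # v) = x # v" by simp
      then show ?thesis by blast
    next
      case False with u have "gen_b (0 # u) = x # v" by simp
      then show ?thesis by blast
    qed }
qed

lemma tree_aut_gens: "tree_aut gen_a" "tree_aut gen_b"
proof -
  have "bij gen_a" "bij gen_b"
    unfolding bij_def inj_def surj_def using gens_inj gens_surj by metis+
  then show "tree_aut gen_a" "tree_aut gen_b"
    by (simp_all add: tree_aut_def gens_length gens_prefix)
qed

lemma tree_aut_inv:
  assumes "tree_aut g"
  shows "tree_aut (inv_into UNIV g)"
proof -
  define h where "h = inv_into UNIV g"
  have b: "bij g" and len: "\<And>u. length (g u) = length u"
    using assms by (simp_all add: tree_aut_def)
  have gh: "g (h u) = u" and hg: "h (g u) = u" for u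
    using b by (simp_all add: h_def bij_is_surj surj_f_inv_f bij_is_inj inv_f_f)
  have l: "length (h u) = length u" for u
    using len[of "h u"] by (simp add: gh)
  have "prefix (h u) (h v)" if "prefix u v" for u v
  proof -
    have "g (take (length u) (h v)) = take (length u) v"
      by (simp add: tree_aut_take[OF assms] gh)
    also have "\<dots> = u" using that by (auto simp: prefix_def)
    finally have "h u = take (length u) (h v)" using hg by metis
    then show ?thesis by (simp add: take_is_prefix)
  qed
  moreover have "bij h" unfolding h_def using b by (rule bij_imp_bij_inv)
  ultimately have "tree_aut h" using l unfolding tree_aut_def by blast
  then show ?thesis unfolding h_def .
qed

lemma tree_aut_comp:
  assumes "tree_aut g" "tree_aut h"
  shows "tree_aut (g \<circ> h)"
proof -
  have "bij (g \<circ> h)" using assms bij_comp[of h g] unfolding tree_aut_def by simp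
  then show ?thesis using assms unfolding tree_aut_def by simp
qed

lemma tree_aut_Bij:
  assumes "tree_aut g"
  shows "g \<in> Bij UNIV"
proof -
  have "bij g" using assms unfolding tree_aut_def by (rule conjunct1)
  then show ?thesis by (simp add: Bij_def)
qed

lemma inv_BijGroup_UNIV:
  assumes "tree_aut g"
  shows "inv\<^bsub>BijGroup UNIV\<^esub> g = inv_into UNIV g"
  unfolding inv_BijGroup[OF tree_aut_Bij[OF assms]] by (rule restrict_UNIV)

lemma mult_BijGroup_UNIV:
  assumes "tree_aut g" "tree_aut h"
  shows "g \<otimes>\<^bsub>BijGroup UNIV\<^esub> h = g \<circ> h"
  using assms[THEN tree_aut_Bij] by (simp add: BijGroup_def compose_def fun_eq_iff)

lemma basilica_tree_aut: "g \<in> basilica_group \<Longrightarrow> tree_aut g"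
  unfolding basilica_group_def
proof (induction rule: generate.induct)
  case one
  show ?case by (simp add: BijGroup_def tree_aut_def bij_def)
next
  case (incl h) then show ?case using tree_aut_gens by blast
next
  case (inv h)
  then have "tree_aut h" using tree_aut_gens by blast
  then show ?case by (simp add: inv_BijGroup_UNIV tree_aut_inv)
next
  case (eng g h)
  then show ?case by (simp only: mult_BijGroup_UNIV tree_aut_comp)
qed

lemma stake_boundary_action:
  assumes "tree_aut g"
  shows "stake n (boundary_action g \<xi>) = g (stake n \<xi>)"
proof (rule nth_equalityI)
  show l: "length (stake n (boundary_action g \<xi>)) = length (g (stake n \<xi>))"
    using assms by (simp add: tree_aut_def)
  fix i assume "i < length (stake n (boundary_action g \<xi>))"
  then have i: "i < n" by simp
  have "g (stake (Suc i) \<xi>) = take (Suc i) (g (stake n \<xi>))"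
    using tree_aut_take[OF assms, of "Suc i" "stake n \<xi>"] i by (simp add: take_stake min_def del: stake.simps)
  then have "g (stake (Suc i) \<xi>) ! i = g (stake n \<xi>) ! i" by (simp del: stake.simps)
  then show "stake n (boundary_action g \<xi>) ! i = g (stake n \<xi>) ! i"
    using i by (simp add: boundary_action_def del: stake.simps)
qed

lemma boundary_action_gens:
  "boundary_action gen_a (0 ## w) = 0 ## boundary_action gen_b w"
  "boundary_action gen_a (1 ## w) = 1 ## w"
  "boundary_action gen_b (0 ## w) = 1 ## boundary_action gen_a w"
  "boundary_action gen_b (1 ## w) = 0 ## w"
proof -
  have eqI: "s = t" if *: "\<And>n. stake n s = stake n t" for s t :: "bit stream"
  proof -
    have "snth s n = snth t n" for n
      using *[of "Suc n"] unfolding stake_Suc by simp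
    then have "snth s = snth t" by (rule ext)
    then show ?thesis using stream_smap_nats[of s] stream_smap_nats[of t] by simp
  qed
  note [simp] = tree_aut_gens[THEN stake_boundary_action]
  show "boundary_action gen_a (0 ## w) = 0 ## boundary_action gen_b w"
  proof (rule eqI)
    show "stake n (boundary_action gen_a (0 ## w)) = stake n (0 ## boundary_action gen_b w)" for n
      by (cases n) simp_all
  qed
  show "boundary_action gen_a (1 ## w) = 1 ## w"
  proof (rule eqI)
    show "stake n (boundary_action gen_a (1 ## w)) = stake n (1 ## w)" for n
      by (cases n) simp_all
  qed
  show "boundary_action gen_b (0 ## w) = 1 ## boundary_action gen_a w"
  proof (rule eqI)
    show "stake n (boundary_action gen_b (0 ## w)) = stake n (1 ## boundary_action gen_a w)" for n
      by (cases n) simp_all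
  qed
  show "boundary_action gen_b (1 ## w) = 0 ## w"
  proof (rule eqI)
    show "stake n (boundary_action gen_b (1 ## w)) = stake n (0 ## w)" for n
      by (cases n) simp_all
  qed
qed

end

theory Submission
  imports Defs "HOL-Library.Infinite_Set"
begin

text \<open>On letters the two generators follow one rule: a generator flips the letter at position \<open>i\<close> exactly
  if \<open>i\<close> has the parity of that generator (even for \<open>b\<close>, odd for \<open>a\<close>) and all earlier letters are
  \<open>0\<close> (lemma \<open>one_at_toggle\<close>).  Two consequences drive everything.  A word other than \<open>0\<^sup>\<omega>\<close> keeps its
  tail under a generator, so outside the orbit of \<open>0\<^sup>\<omega>\<close> an orbit is a class of words with a common tail
  (\<open>orbit_nonexceptional\<close>).  And if the letter of \<open>\<xi>\<close> at position \<open>n\<close> is \<open>1\<close>, then the finite set \<open>F\<close> of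
  words that agree with \<open>\<xi>\<close> from \<open>n\<close> on is attached to the rest of the graph in at most two places: only the
  generator of the parity of \<open>n\<close> leaves or enters \<open>F\<close>, and it does so at one vertex each
  (\<open>agree_from_exit\<close>, \<open>agree_from_entry\<close>).  So deleting \<open>F\<close> leaves one or two pieces, according to whether
  the two neighbours just outside \<open>F\<close>, its gates, are still joined.

  If letters \<open>1\<close> occur infinitely often at both parities, the orbit of the leaving vertex under its
  generator is finite, because a later \<open>1\<close> of the other parity stops that generator.  Going round this
  cycle joins the gates outside \<open>F\<close>, and there is one end (\<open>one_end\<close>).  If the letters \<open>1\<close>
  of \<open>\<xi>\<close> eventually occur at a single parity and \<open>\<xi>\<close> is not in the orbit of \<open>0\<^sup>\<omega>\<close>, the generator of that parity acts on the tail of \<open>\<xi>\<close> as a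
  binary odometer with an infinite orbit.  Comparing a word with \<open>\<xi>\<close> at the last place where
  they differ then tells the two sides of this line apart, and there are two ends (\<open>two_ends\<close>).

  The orbit of \<open>0\<^sup>\<omega>\<close> is exceptional: both generators have infinite orbits through \<open>0\<^sup>\<omega>\<close>, and these four
  half-lines give four ends.  The half-line on which a word hangs can be read off its tail: a word
  ending in \<open>0\<^sup>\<omega>\<close> is classified by the parity of its last \<open>1\<close>, and a word ending in an
  alternating tail by the parity of the \<open>1\<close>s (\<open>arm\<close>, \<open>four_ends\<close>).

  All three counts use one principle (\<open>coloured_cuts\<close>).  Suppose that vertices are coloured and that
  every finite vertex set lies in a finite cut such that outside the cut edges preserve colours, all
  colours occur, and gates of equal colour are connected.  Then the ends correspond to the colours.\<close>

section \<open>Counting the ends of a graph by colouring\<close>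

lemma adjacent_sym: "adjacent G x y \<Longrightarrow> adjacent G y x"
  unfolding adjacent_def by (simp add: insert_commute)

lemma component_avoiding_refl [simp]: "x \<in> component_avoiding G S x"
  unfolding component_avoiding_def by simp

lemma component_avoiding_trans:
  "y \<in> component_avoiding G S x \<Longrightarrow> z \<in> component_avoiding G S y \<Longrightarrow> z \<in> component_avoiding G S x"
  unfolding component_avoiding_def by simp

lemma component_avoiding_step:
  "adjacent G x y \<Longrightarrow> x \<notin> S \<Longrightarrow> y \<notin> S \<Longrightarrow> y \<in> component_avoiding G S x"
  unfolding component_avoiding_def by auto

lemma component_avoiding_sym:
  assumes "y \<in> component_avoiding G S x"
  shows "x \<in> component_avoiding G S y"
proof -
  have "sym {(u, v). u \<notin> S \<and> v \<notin> S \<and> adjacent G u v}"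
    by (auto simp: sym_def intro: adjacent_sym)
  from symD[OF sym_rtrancl[OF this]] show ?thesis
    using assms unfolding component_avoiding_def by blast
qed

lemma component_avoiding_antimono:
  assumes "S \<subseteq> T"
  shows "component_avoiding G T x \<subseteq> component_avoiding G S x"
proof -
  have "{(u, v). u \<notin> T \<and> v \<notin> T \<and> adjacent G u v} \<subseteq> {(u, v). u \<notin> S \<and> v \<notin> S \<and> adjacent G u v}"
    using assms by auto
  from rtrancl_mono[OF this] show ?thesis
    unfolding component_avoiding_def by auto
qed

text \<open>Deleting the starting vertex of a component leaves finitely many pieces, one at each neighbour,
  so one of them is infinite again.  This is the step of Koenig's argument.\<close>

lemma infinite_component_step:
  assumes lf: "\<And>x. finite {y. adjacent G x y}"
    and inf: "infinite (component_avoiding G S x)"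
  shows "\<exists>y. adjacent G x y \<and> y \<notin> insert x S \<and> infinite (component_avoiding G (insert x S) y)"
proof (rule ccontr)
  assume neg: "\<not> ?thesis"
  let ?N = "{y. adjacent G x y \<and> y \<notin> insert x S}"
  have "z \<in> insert x (\<Union>y\<in>?N. component_avoiding G (insert x S) y)"
    if "z \<in> component_avoiding G S x" for z
    using that unfolding component_avoiding_def mem_Collect_eq
  proof (induction rule: rtrancl_induct)
    case (step u v)
    show ?case
    proof (cases "u = x \<or> v = x")
      case True
      then show ?thesis using step.hyps by auto
    next
      case False
      with step have "(u, v) \<in> {(u, v). u \<notin> insert x S \<and> v \<notin> insert x S \<and> adjacent G u v}"
        by auto
      with step.IH False show ?thesis by (auto intro: rtrancl.rtrancl_into_rtrancl)
    qed
  qed simp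
  then have "component_avoiding G S x \<subseteq> insert x (\<Union>y\<in>?N. component_avoiding G (insert x S) y)"
    by blast
  moreover have "finite ?N"
    using lf[of x] by (rule rev_finite_subset) auto
  then have "finite (insert x (\<Union>y\<in>?N. component_avoiding G (insert x S) y))"
    using neg by auto
  ultimately show False using inf finite_subset by blast
qed

text \<open>Koenig's lemma inside a component: repeating the previous step forever yields a ray, since every
  vertex passed is forbidden from then on.\<close>

lemma infinite_component_ray:
  assumes lf: "\<And>x. finite {y. adjacent G x y}"
    and vs: "\<And>x y. adjacent G x y \<Longrightarrow> x \<in> verts G"
    and inf: "infinite (component_avoiding G S x)" and "x \<notin> S"
  shows "\<exists>r. is_ray G r \<and> (\<forall>n. r n \<in> component_avoiding G S x)"
proof -
  \<comment> \<open>A state is the set of vertices already forbidden, together with the current vertex.\<close>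
  define P where "P = (\<lambda>(n::nat) (T, y). S \<subseteq> T \<and> y \<notin> T \<and> y \<in> component_avoiding G S x
    \<and> infinite (component_avoiding G T y))"
  define Q where "Q = (\<lambda>(n::nat) (T, y) (T', y'). T' = insert y T \<and> adjacent G y y')"
  have "\<exists>f. \<forall>n. P n (f n) \<and> Q n (f n) (f (Suc n))"
  proof (rule dependent_nat_choice)
    show "\<exists>s. P 0 s"
      by (rule exI[of _ "(S, x)"]) (use assms in \<open>auto simp: P_def\<close>)
  next
    fix s n assume s: "P n s"
    obtain T y where [simp]: "s = (T, y)" by (cases s)
    from s obtain y' where y': "adjacent G y y'" "y' \<notin> insert y T"
        "infinite (component_avoiding G (insert y T) y')"
      using infinite_component_step[OF lf, of T y] unfolding P_def by auto
    have "y' \<in> component_avoiding G S x"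
      using s y' component_avoiding_step[of G y y' S] component_avoiding_trans[of y G S x y']
      unfolding P_def by auto
    with s y' have "P (Suc n) (insert y T, y') \<and> Q n s (insert y T, y')"
      unfolding P_def Q_def by auto
    then show "\<exists>t. P (Suc n) t \<and> Q n s t" by blast
  qed
  then obtain f where f: "\<And>n. P n (f n)" "\<And>n. Q n (f n) (f (Suc n))" by blast
  define r where "r n = snd (f n)" for n
  have fst_Suc: "fst (f (Suc n)) = insert (r n) (fst (f n))" for n
    using f(2)[of n] unfolding Q_def r_def by (auto split: prod.splits)
  have adj: "adjacent G (r n) (r (Suc n))" for n
    using f(2)[of n] unfolding Q_def r_def by (auto split: prod.splits)
  have notin: "r n \<notin> fst (f n)" and comp: "r n \<in> component_avoiding G S x" for n
    using f(1)[of n] unfolding P_def r_def by (auto split: prod.splits)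
  have earlier: "r m \<in> fst (f n)" if "m < n" for m n
    using that by (induction n) (auto simp: fst_Suc less_Suc_eq)
  have "inj r"
    by (rule linorder_injI) (use earlier notin in metis)
  with adj vs comp show ?thesis unfolding is_ray_def by blast
qed

lemma card_quotient_kernel:
  assumes "finite (f ` A)"
  shows "finite (A // {(x, y). x \<in> A \<and> y \<in> A \<and> f x = f y})"
    and "card (A // {(x, y). x \<in> A \<and> y \<in> A \<and> f x = f y}) = card (f ` A)"
proof -
  have eq: "A // {(x, y). x \<in> A \<and> y \<in> A \<and> f x = f y} = (\<lambda>i. {x \<in> A. f x = i}) ` f ` A"
  proof -
    have "{(x, y). x \<in> A \<and> y \<in> A \<and> f x = f y} `` {x} = {y \<in> A. f y = f x}" if "x \<in> A" for x
      using that by auto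
    then show ?thesis unfolding quotient_def by blast
  qed
  have "inj_on (\<lambda>i. {x \<in> A. f x = i}) (f ` A)"
    by (rule inj_onI) blast
  with assms show "finite (A // {(x, y). x \<in> A \<and> y \<in> A \<and> f x = f y})"
    and "card (A // {(x, y). x \<in> A \<and> y \<in> A \<and> f x = f y}) = card (f ` A)"
    unfolding eq by (auto intro: card_image)
qed

text \<open>A gate of a cut \<open>F\<close> is a vertex outside \<open>F\<close> with a neighbour in \<open>F\<close>.  Since the graph is connected, every
  vertex outside \<open>F\<close> reaches a gate without meeting \<open>F\<close>.  Hence connecting the gates of each colour is
  enough to make the complement of \<open>F\<close> fall into exactly one component for each colour.\<close>

locale coloured_cuts =
  fixes G :: "('v, 'e) multigraph"
    and cuts :: "'v set set"
    and colour :: "'v \<Rightarrow> 'c"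
    and colours :: "'c set"
  assumes adjacent_verts: "adjacent G x y \<Longrightarrow> x \<in> verts G"
    and locally_finite: "finite {y. adjacent G x y}"
    and connected: "x \<in> verts G \<Longrightarrow> y \<in> verts G \<Longrightarrow> y \<in> component_avoiding G {} x"
    and finite_cut: "F \<in> cuts \<Longrightarrow> finite F"
    and nonempty_cut: "F \<in> cuts \<Longrightarrow> F \<noteq> {}"
    and cut_verts: "F \<in> cuts \<Longrightarrow> F \<subseteq> verts G"
    and exhausting: "finite S \<Longrightarrow> S \<subseteq> verts G \<Longrightarrow> \<exists>F\<in>cuts. S \<subseteq> F"
    and colour_adjacent: "F \<in> cuts \<Longrightarrow> adjacent G x y \<Longrightarrow> x \<notin> F \<Longrightarrow> y \<notin> F \<Longrightarrow> colour x = colour y"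
    and gates_connected: "F \<in> cuts \<Longrightarrow> adjacent G x y \<Longrightarrow> x \<notin> F \<Longrightarrow> y \<in> F \<Longrightarrow>
      adjacent G x' y' \<Longrightarrow> x' \<notin> F \<Longrightarrow> y' \<in> F \<Longrightarrow> colour x = colour x' \<Longrightarrow>
      x' \<in> component_avoiding G F x"
    and colours_outside: "F \<in> cuts \<Longrightarrow> colour ` (verts G - F) = colours"
    and finite_colours: "finite colours"
begin

lemma reaches_gate:
  assumes F: "F \<in> cuts" and x: "x \<in> verts G" "x \<notin> F"
  shows "\<exists>g y. g \<in> component_avoiding G F x \<and> adjacent G g y \<and> g \<notin> F \<and> y \<in> F"
proof -
  obtain v where v: "v \<in> F" "v \<in> verts G"
    using nonempty_cut[OF F] cut_verts[OF F] by blast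
  have "(x, v) \<in> {(u, v). u \<notin> {} \<and> v \<notin> {} \<and> adjacent G u v}\<^sup>*"
    using connected[OF x(1) v(2)] unfolding component_avoiding_def by simp
  then show ?thesis using x(2)
  proof (induction rule: converse_rtrancl_induct)
    case base
    then show ?case using v by blast
  next
    case (step z z')
    then have adj: "adjacent G z z'" by simp
    show ?case
    proof (cases "z' \<in> F")
      case True
      then show ?thesis
        using adj step.prems by (intro exI[of _ z] exI[of _ z']) simp
    next
      case False
      then show ?thesis
        using step.IH component_avoiding_trans[OF component_avoiding_step[OF adj step.prems False]]
        by blast
    qed
  qed
qed

lemma colour_component:
  assumes "F \<in> cuts" "y \<in> component_avoiding G F x"
  shows "colour y = colour x"
  using assms(2) unfolding component_avoiding_def mem_Collect_eq
proof (induction rule: rtrancl_induct)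
  case (step u v)
  then have "colour u = colour v"
    by (intro colour_adjacent[OF assms(1)]) auto
  then show ?case using step.IH by simp
qed simp

text \<open>Both vertices reach gates of their common colour, and these gates are connected.\<close>

lemma same_colour_component:
  assumes F: "F \<in> cuts" and x: "x \<in> verts G" "x \<notin> F" and y: "y \<in> verts G" "y \<notin> F"
    and "colour x = colour y"
  shows "y \<in> component_avoiding G F x"
proof -
  obtain g z where g: "g \<in> component_avoiding G F x" "adjacent G g z" "g \<notin> F" "z \<in> F"
    using reaches_gate[OF F x] by blast
  obtain g' z' where g': "g' \<in> component_avoiding G F y" "adjacent G g' z'" "g' \<notin> F" "z' \<in> F"
    using reaches_gate[OF F y] by blast
  have "colour g = colour g'"
    using colour_component[OF F g(1)] colour_component[OF F g'(1)] assms by simp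
  then have "g' \<in> component_avoiding G F g"
    using gates_connected[OF F] g g' by blast
  then show ?thesis
    using g(1) g'(1) component_avoiding_trans component_avoiding_sym by metis
qed

lemma ray_leaves_cut:
  assumes r: "is_ray G r" and F: "F \<in> cuts"
  shows "\<exists>N. \<forall>n\<ge>N. r n \<in> verts G \<and> r n \<notin> F"
proof -
  have "finite (r -` F)"
    using r finite_cut[OF F] unfolding is_ray_def by (auto intro: finite_vimageI)
  then obtain N where "\<forall>n\<in>r -` F. n < N"
    using finite_nat_set_iff_bounded by blast
  then have "r n \<notin> F" if "n \<ge> N" for n
    using that by (metis linorder_not_less vimageI)
  then show ?thesis using r unfolding is_ray_def by blast
qed

text \<open>A ray visits every vertex at most once, so it eventually leaves any cut.  From then on its colour is
  constant; this eventual colour labels the end of the ray.\<close>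

definition ray_colour :: "(nat \<Rightarrow> 'v) \<Rightarrow> 'c" where
  "ray_colour r = (THE i. \<exists>N. \<forall>n\<ge>N. colour (r n) = i)"

lemma ray_colour_eqI:
  assumes "\<And>n. n \<ge> N \<Longrightarrow> colour (r n) = i"
  shows "ray_colour r = i"
  unfolding ray_colour_def
proof (rule the_equality)
  fix j assume "\<exists>N. \<forall>n\<ge>N. colour (r n) = j"
  then obtain M where "\<forall>n\<ge>M. colour (r n) = j" by blast
  then show "j = i" using assms[of "max M N"] by simp
qed (use assms in blast)

lemma ray_colour_outside:
  assumes r: "is_ray G r" and F: "F \<in> cuts" and N: "\<And>n. n \<ge> N \<Longrightarrow> r n \<notin> F" and "n \<ge> N"
  shows "colour (r n) = ray_colour r"
proof -
  have const: "colour (r n) = colour (r N)" if "n \<ge> N" for n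
    using that
  proof (induction n rule: dec_induct)
    case (step n)
    have "adjacent G (r n) (r (Suc n))" using r unfolding is_ray_def by blast
    then have "colour (r n) = colour (r (Suc n))"
      using colour_adjacent[OF F] N step.hyps by simp
    then show ?case using step.IH by simp
  qed simp
  have "ray_colour r = colour (r N)" by (rule ray_colour_eqI) (rule const)
  with const[OF \<open>n \<ge> N\<close>] show ?thesis by simp
qed

lemma ray_equiv_iff_colour:
  "ray_equiv G = {(r, r'). r \<in> {r. is_ray G r} \<and> r' \<in> {r. is_ray G r} \<and> ray_colour r = ray_colour r'}"
proof -
  have "ray_colour r = ray_colour r'" if "(r, r') \<in> ray_equiv G" for r r'
  proof -
    have r: "is_ray G r" "is_ray G r'" using that unfolding ray_equiv_def by auto
    obtain F where F: "F \<in> cuts" using exhausting[of "{}"] by blast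
    have "\<forall>S. finite S \<and> S \<subseteq> verts G \<longrightarrow>
        (\<exists>C\<in>components_avoiding G S. \<exists>N. \<forall>n\<ge>N. r n \<in> C \<and> r' n \<in> C)"
      using that unfolding ray_equiv_def by simp
    then have "\<exists>C\<in>components_avoiding G F. \<exists>N. \<forall>n\<ge>N. r n \<in> C \<and> r' n \<in> C"
      using finite_cut[OF F] cut_verts[OF F] by simp
    then obtain C N where C: "C \<in> components_avoiding G F" "\<And>n. n \<ge> N \<Longrightarrow> r n \<in> C \<and> r' n \<in> C"
      by auto
    obtain x where x: "C = component_avoiding G F x"
      using C(1) unfolding components_avoiding_def by blast
    have "ray_colour r = colour x" "ray_colour r' = colour x"
      using C(2) colour_component[OF F] unfolding x by (auto intro: ray_colour_eqI)
    then show ?thesis by simp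
  qed
  moreover have "(r, r') \<in> ray_equiv G"
    if r: "is_ray G r" "is_ray G r'" and eq: "ray_colour r = ray_colour r'" for r r'
    unfolding ray_equiv_def
  proof (clarsimp simp: r)
    fix S assume "finite S" "S \<subseteq> verts G"
    then obtain F where F: "F \<in> cuts" "S \<subseteq> F" using exhausting by blast
    obtain N where N: "\<And>n. n \<ge> N \<Longrightarrow> r n \<in> verts G \<and> r n \<notin> F"
      using ray_leaves_cut[OF r(1) F(1)] by blast
    obtain N' where N': "\<And>n. n \<ge> N' \<Longrightarrow> r' n \<in> verts G \<and> r' n \<notin> F"
      using ray_leaves_cut[OF r(2) F(1)] by blast
    let ?M = "max N N'"
    have "colour (r n) = ray_colour r" "colour (r' n) = ray_colour r" if "n \<ge> ?M" for n
      using ray_colour_outside[OF r(1) F(1), of N n] ray_colour_outside[OF r(2) F(1), of N' n]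
        N N' that eq by auto
    then have "r n \<in> component_avoiding G F (r ?M)" "r' n \<in> component_avoiding G F (r ?M)"
      if "n \<ge> ?M" for n
      using that N N' by (auto intro!: same_colour_component[OF F(1)])
    then have "\<forall>n\<ge>?M. r n \<in> component_avoiding G S (r ?M) \<and> r' n \<in> component_avoiding G S (r ?M)"
      using component_avoiding_antimono[OF F(2)] by blast
    moreover have "component_avoiding G S (r ?M) \<in> components_avoiding G S"
      using N[of ?M] F(2) unfolding components_avoiding_def by auto
    ultimately show "\<exists>C\<in>components_avoiding G S. \<exists>N. \<forall>n\<ge>N. r n \<in> C \<and> r' n \<in> C" by blast
  qed
  moreover have "is_ray G r \<and> is_ray G r'" if "(r, r') \<in> ray_equiv G" for r r'
    using that unfolding ray_equiv_def by simp
  ultimately have "p \<in> ray_equiv G \<longleftrightarrow>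
      is_ray G (fst p) \<and> is_ray G (snd p) \<and> ray_colour (fst p) = ray_colour (snd p)" for p
    by (metis prod.collapse)
  then show ?thesis by (simp add: set_eq_iff case_prod_beta)
qed

text \<open>The component of a colour is infinite, for otherwise a larger cut would contain all of it and no
  vertex of that colour would be left outside.  So it contains a ray.\<close>

lemma ray_of_colour:
  assumes "i \<in> colours"
  shows "\<exists>r. is_ray G r \<and> ray_colour r = i"
proof -
  obtain F where F: "F \<in> cuts" using exhausting[of "{}"] by blast
  obtain x where x: "x \<in> verts G" "x \<notin> F" "colour x = i"
    using colours_outside[OF F] assms by blast
  have "infinite (component_avoiding G F x)"
  proof
    assume fin: "finite (component_avoiding G F x)"
    have "component_avoiding G F x \<inter> verts G \<union> F \<subseteq> verts G" using cut_verts[OF F] by blast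
    then obtain F' where F': "F' \<in> cuts" "component_avoiding G F x \<inter> verts G \<union> F \<subseteq> F'"
      using exhausting[of "component_avoiding G F x \<inter> verts G \<union> F"] fin finite_cut[OF F] by blast
    obtain y where y: "y \<in> verts G" "y \<notin> F'" "colour y = i"
      using colours_outside[OF F'(1)] assms by blast
    then have "y \<in> component_avoiding G F x"
      using F' x by (intro same_colour_component[OF F]) auto
    then show False using F' y by blast
  qed
  then obtain r where r: "is_ray G r" "\<And>n. r n \<in> component_avoiding G F x"
    using infinite_component_ray[OF locally_finite _ _ x(2)] adjacent_verts by blast
  then have "ray_colour r = i"
    using colour_component[OF F] x(3) by (auto intro: ray_colour_eqI)
  with r show ?thesis by blast
qed

theorem ends_coloured: "finite (graph_ends G)" "card (graph_ends G) = card colours"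
proof -
  have "ray_colour r \<in> colours" if r: "is_ray G r" for r
  proof -
    obtain F where F: "F \<in> cuts" using exhausting[of "{}"] by blast
    obtain N where N: "\<And>n. n \<ge> N \<Longrightarrow> r n \<in> verts G \<and> r n \<notin> F"
      using ray_leaves_cut[OF r F] by blast
    then have "colour (r N) = ray_colour r"
      using ray_colour_outside[OF r F, of N N] by blast
    moreover have "colour (r N) \<in> colour ` (verts G - F)" using N[of N] by simp
    ultimately show ?thesis using colours_outside[OF F] by simp
  qed
  then have img: "ray_colour ` {r. is_ray G r} = colours"
    using ray_of_colour by (auto simp: image_iff)
  show "finite (graph_ends G)" "card (graph_ends G) = card colours"
    using card_quotient_kernel[of ray_colour "{r. is_ray G r}"] finite_colours
    unfolding img graph_ends_def ray_equiv_iff_colour by auto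
qed

end

section \<open>The Basilica group on infinite words\<close>

text \<open>Words are handled through the predicate that tells where their letters \<open>1\<close> are, so that
  reasoning about letters becomes propositional.\<close>

definition one_at :: "bit stream \<Rightarrow> nat \<Rightarrow> bool" where
  "one_at x i \<longleftrightarrow> x !! i = 1"

definition word :: "(nat \<Rightarrow> bool) \<Rightarrow> bit stream" where
  "word f = smap (\<lambda>i. of_bool (f i)) nats"

lemma one_at_word [simp]: "one_at (word f) = f"
  by (simp add: one_at_def word_def fun_eq_iff)

lemma word_eqI:
  assumes "\<And>i. one_at x i = one_at y i"
  shows "x = y"
proof -
  have "x !! i = y !! i" for i
    using assms[of i] unfolding one_at_def by (metis bit_not_one_iff)
  then have "snth x = snth y" by (rule ext)
  then show ?thesis using stream_smap_nats[of x] stream_smap_nats[of y] by simp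
qed

lemma one_at_SCons [simp]:
  "one_at (x ## w) i = (case i of 0 \<Rightarrow> x = 1 | Suc j \<Rightarrow> one_at w j)"
  by (simp add: one_at_def split: nat.split)

text \<open>The argument is the parity of the positions that the generator may flip: \<open>True\<close>, the even
  ones, for \<open>b\<close>, and \<open>False\<close> for \<open>a\<close>.\<close>

definition toggle :: "bool \<Rightarrow> bit stream \<Rightarrow> bit stream" where
  "toggle p = boundary_action (if p then gen_b else gen_a)"

lemma toggle_SCons:
  "toggle p (0 ## w) = of_bool p ## toggle (\<not> p) w"
  "toggle p (1 ## w) = of_bool (\<not> p) ## w"
  by (cases p; simp add: toggle_def boundary_action_gens)+

text \<open>Unfolding the recursion of the generators along the leading zeros: each of them passes the word on to
  the other generator, which shifts the parity by one, and the first \<open>1\<close> stops the recursion.\<close>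

lemma one_at_toggle:
  "one_at (toggle p x) i \<longleftrightarrow> (one_at x i \<noteq> (even i = p \<and> (\<forall>j<i. \<not> one_at x j)))"
proof (induction i arbitrary: p x)
  case 0
  obtain d w where x: "x = d ## w" by (cases x) auto
  show ?case
    unfolding x by (cases d; cases p) (simp_all add: toggle_SCons)
next
  case (Suc i)
  obtain d w where x: "x = d ## w" by (cases x) auto
  have d: "d = 0 \<or> d = 1" by (cases d) simp_all
  have below: "(\<forall>j<Suc i. \<not> one_at (d ## w) j) \<longleftrightarrow> d = 0 \<and> (\<forall>j<i. \<not> one_at w j)"
    using d by (auto simp: All_less_Suc2)
  show ?case
    unfolding x below using d Suc.IH[of "\<not> p" w] by (auto simp: toggle_SCons)
qed

lemma stake_eqI:
  assumes "\<And>n. stake n x = stake n y"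
  shows "x = y"
proof -
  have "x !! i = y !! i" for i
    using assms[of "Suc i"] stake_nth[of i "Suc i"] by (metis lessI)
  then show ?thesis using stream_smap_nats[of x] stream_smap_nats[of y] by presburger
qed

lemma boundary_action_comp:
  assumes "tree_aut g" "tree_aut h"
  shows "boundary_action (g \<circ> h) x = boundary_action g (boundary_action h x)"
  by (rule stake_eqI) (simp add: stake_boundary_action tree_aut_comp assms)

lemma boundary_action_id: "boundary_action id x = x"
proof -
  have "tree_aut id" by (simp add: tree_aut_def)
  then show ?thesis by (intro stake_eqI) (simp add: stake_boundary_action)
qed

lemma boundary_action_inv:
  assumes "tree_aut g"
  shows "boundary_action g (boundary_action (inv_into UNIV g) x) = x"
    and "boundary_action (inv_into UNIV g) (boundary_action g x) = x"
proof -
  have b: "bij g" using assms by (simp add: tree_aut_def)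
  then have "g \<circ> inv_into UNIV g = id" "inv_into UNIV g \<circ> g = id"
    by (simp_all only: surj_iff[THEN iffD1, OF bij_is_surj] inj_iff[THEN iffD1, OF bij_is_inj])
  then show "boundary_action g (boundary_action (inv_into UNIV g) x) = x"
    and "boundary_action (inv_into UNIV g) (boundary_action g x) = x"
    using boundary_action_comp[OF assms tree_aut_inv[OF assms], of x]
      boundary_action_comp[OF tree_aut_inv[OF assms] assms, of x]
    by (simp_all add: boundary_action_id)
qed

lemma toggle_inject:
  assumes "toggle p x = toggle p y"
  shows "x = y"
proof -
  define s where "s = (if p then gen_b else gen_a)"
  have s: "tree_aut s" using tree_aut_gens by (simp add: s_def)
  have "boundary_action s x = boundary_action s y"
    using assms unfolding toggle_def s_def .
  then show ?thesis using boundary_action_inv(2)[OF s] by metis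
qed

definition linked :: "bit stream \<Rightarrow> bit stream \<Rightarrow> bool" where
  "linked x y \<longleftrightarrow> (\<exists>p. y = toggle p x \<or> x = toggle p y)"

lemma linked_sym: "linked x y \<Longrightarrow> linked y x"
  unfolding linked_def by blast

lemma linked_rtranclp_sym: "linked\<^sup>*\<^sup>* x y \<Longrightarrow> linked\<^sup>*\<^sup>* y x"
  by (induction rule: rtranclp_induct) (auto intro: linked_sym converse_rtranclp_into_rtranclp)

lemma linked_toggle: "linked x (toggle p x)"
  unfolding linked_def by blast

text \<open>The group enters the graph only through its orbits, and these are the classes of the relation
  generated by single applications of the two generators.\<close>

lemma basilica_orbit_linked: "basilica_orbit x = {y. linked\<^sup>*\<^sup>* x y}"
proof (intro equalityI subsetI)
  fix y assume "y \<in> basilica_orbit x"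
  then obtain g where g: "g \<in> basilica_group" and y: "y = boundary_action g x"
    unfolding basilica_orbit_def by blast
  have gen: "linked z (boundary_action h z)" if "h \<in> {gen_a, gen_b}" for h z
    using that linked_toggle[of z True] linked_toggle[of z False] by (auto simp: toggle_def)
  have "linked\<^sup>*\<^sup>* z (boundary_action g z)" for z
    using g unfolding basilica_group_def
  proof (induction arbitrary: z rule: generate.induct)
    case one
    have "\<one>\<^bsub>BijGroup UNIV\<^esub> = (id :: bit list \<Rightarrow> bit list)" by (auto simp: BijGroup_def)
    then show ?case by (simp only: boundary_action_id rtranclp.rtrancl_refl)
  next
    case (incl h)
    then show ?case using gen by blast
  next
    case (inv h)
    then have h: "tree_aut h" using tree_aut_gens by blast
    have "linked (boundary_action (inv_into UNIV h) z) z"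
      using gen[OF inv, of "boundary_action (inv_into UNIV h) z"] by (simp add: boundary_action_inv(1)[OF h])
    then show ?case by (simp add: inv_BijGroup_UNIV[OF h] linked_sym r_into_rtranclp)
  next
    case (eng g h)
    then have t: "tree_aut g" "tree_aut h"
      using basilica_tree_aut unfolding basilica_group_def by blast+
    show ?case
      unfolding mult_BijGroup_UNIV[OF t] boundary_action_comp[OF t]
      using eng.IH by (meson rtranclp_trans)
  qed
  then show "y \<in> {y. linked\<^sup>*\<^sup>* x y}" unfolding y by simp
next
  fix y assume "y \<in> {y. linked\<^sup>*\<^sup>* x y}"
  then have "linked\<^sup>*\<^sup>* x y" by simp
  then show "y \<in> basilica_orbit x"
  proof (induction rule: rtranclp_induct)
    case base
    have "\<one>\<^bsub>BijGroup UNIV\<^esub> = (id :: bit list \<Rightarrow> bit list)" by (auto simp: BijGroup_def)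
    then have "id \<in> basilica_group"
      using generate.one[of "BijGroup UNIV" "{gen_a, gen_b}"] unfolding basilica_group_def by simp
    then show ?case
      unfolding basilica_orbit_def using boundary_action_id[of x] by force
  next
    case (step y z)
    obtain g where g: "g \<in> basilica_group" and y: "y = boundary_action g x"
      using step.IH unfolding basilica_orbit_def by blast
    have act: "boundary_action h y \<in> basilica_orbit x" if h: "h \<in> basilica_group" for h
    proof -
      have t: "tree_aut h" "tree_aut g" using h g basilica_tree_aut by auto
      have "h \<circ> g \<in> basilica_group"
        using generate.eng[of h "BijGroup UNIV" _ g] h g
        unfolding basilica_group_def mult_BijGroup_UNIV[OF t] by blast
      then show ?thesis
        unfolding basilica_orbit_def y boundary_action_comp[OF t, symmetric] by blast
    qed
    obtain p where "z = toggle p y \<or> y = toggle p z"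
      using step.hyps(2) unfolding linked_def by blast
    moreover define s where "s = (if p then gen_b else gen_a)"
    ultimately have z: "z = boundary_action s y \<or> z = boundary_action (inv_into UNIV s) y"
      using boundary_action_inv(2)[of s z] tree_aut_gens unfolding toggle_def by (cases p) auto
    have s: "s \<in> {gen_a, gen_b}" "tree_aut s" using tree_aut_gens by (auto simp: s_def)
    have "s \<in> basilica_group" "inv_into UNIV s \<in> basilica_group"
      using generate.incl[OF s(1), of "BijGroup UNIV"] generate.inv[OF s(1), of "BijGroup UNIV"]
      unfolding basilica_group_def inv_BijGroup_UNIV[OF s(2)] by auto
    then show ?case using act z by blast
  qed
qed

lemma adjacent_schreier_graph:
  "adjacent (schreier_graph \<xi>) x y \<longleftrightarrow>
    x \<in> basilica_orbit \<xi> \<and> y \<in> basilica_orbit \<xi> \<and> linked x y" (is "?L \<longleftrightarrow> ?R")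
proof
  assume ?L
  then obtain z p where z: "z \<in> basilica_orbit \<xi>" "{z, toggle p z} = {x, y}"
    unfolding adjacent_def schreier_graph_def toggle_def by (auto split: if_splits) (metis+)?
  moreover have "toggle p z \<in> basilica_orbit \<xi>"
    using z(1) linked_toggle[of z p] unfolding basilica_orbit_linked
    by (auto intro: rtranclp.rtrancl_into_rtrancl)
  ultimately show ?R unfolding linked_def by (auto simp: doubleton_eq_iff)
next
  assume R: ?R
  have "adjacent (schreier_graph \<xi>) z (toggle p z)" if "z \<in> basilica_orbit \<xi>" for z p
    using that unfolding adjacent_def schreier_graph_def toggle_def
    by (intro bexI[of _ "(z, if p then gen_b else gen_a)"]) auto
  then show ?L using R adjacent_sym unfolding linked_def by metis
qed

lemma finite_linked: "finite {y. linked x y}"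
proof -
  have "{y. linked x y} \<subseteq> (\<Union>p. {toggle p x} \<union> toggle p -` {x})"
    unfolding linked_def by auto
  moreover have "finite (toggle p -` {x})" for p
    by (intro finite_vimageI injI) (auto dest: toggle_inject)
  then have "finite (\<Union>p. {toggle p x} \<union> toggle p -` {x})" by simp
  ultimately show ?thesis by (rule finite_subset)
qed

lemma schreier_graph_component:
  assumes "x \<in> basilica_orbit \<xi>" "y \<in> basilica_orbit \<xi>"
  shows "y \<in> component_avoiding (schreier_graph \<xi>) {} x"
proof -
  have x: "linked\<^sup>*\<^sup>* \<xi> x" and y: "linked\<^sup>*\<^sup>* \<xi> y"
    using assms unfolding basilica_orbit_linked by auto
  have "linked\<^sup>*\<^sup>* x y" using linked_rtranclp_sym[OF x] y by simp
  then show ?thesis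
  proof (induction rule: rtranclp_induct)
    case (step y z)
    have "linked\<^sup>*\<^sup>* \<xi> y" using x step.hyps(1) by simp
    then have "adjacent (schreier_graph \<xi>) y z"
      using step.hyps(2) unfolding adjacent_schreier_graph basilica_orbit_linked
      by (auto intro: rtranclp.rtrancl_into_rtrancl)
    then show ?case
      using step.IH component_avoiding_step component_avoiding_trans by (metis empty_iff)
  qed simp
qed

section \<open>Words with a common tail\<close>

definition agree_from :: "nat \<Rightarrow> bit stream \<Rightarrow> bit stream \<Rightarrow> bool" where
  "agree_from n x y \<longleftrightarrow> (\<forall>i\<ge>n. one_at x i = one_at y i)"

lemma agree_fromD: "agree_from n x y \<Longrightarrow> n \<le> i \<Longrightarrow> one_at y i = one_at x i"
  by (simp add: agree_from_def)

lemma agree_from_refl [simp]: "agree_from n x x"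
  by (simp add: agree_from_def)

lemma agree_from_sym: "agree_from n x y \<Longrightarrow> agree_from n y x"
  by (simp add: agree_from_def)

lemma agree_from_trans: "agree_from n x y \<Longrightarrow> agree_from n y z \<Longrightarrow> agree_from n x z"
  by (simp add: agree_from_def)

lemma agree_from_mono: "agree_from m x y \<Longrightarrow> m \<le> n \<Longrightarrow> agree_from n x y"
  by (auto simp: agree_from_def)

lemma finite_agree_from: "finite {y. agree_from n x y}"
proof -
  have "y \<in> (\<lambda>u. u @- sdrop n x) ` {u. set u \<subseteq> UNIV \<and> length u = n}" if "agree_from n x y" for y
  proof
    show "y = stake n y @- sdrop n x"
    proof (rule word_eqI)
      fix i
      show "one_at y i = one_at (stake n y @- sdrop n x) i"
        using that by (cases "i < n") (auto simp: one_at_def agree_from_def stake_nth sdrop_snth)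
    qed
  qed simp
  moreover have "finite {u :: bit list. set u \<subseteq> UNIV \<and> length u = n}"
  proof (rule finite_lists_length_eq)
    have "(UNIV :: bit set) = {0, 1}" using bit_not_one_iff by auto
    then show "finite (UNIV :: bit set)" by (metis finite.emptyI finite_insert)
  qed
  ultimately show ?thesis
    by (metis (no_types, lifting) finite_imageI finite_subset mem_Collect_eq subsetI)
qed

lemma last_disagreement:
  assumes "\<not> agree_from n x y" "agree_from k x y"
  obtains d where "n \<le> d" "d < k" "one_at x d \<noteq> one_at y d" "agree_from (Suc d) x y"
proof -
  have "\<exists>d\<ge>n. d < k \<and> one_at x d \<noteq> one_at y d \<and> agree_from (Suc d) x y"
    using assms(2)
  proof (induction k)
    case 0
    then show ?case using assms(1) agree_from_mono by blast
  next
    case (Suc k)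
    show ?case
    proof (cases "one_at x k = one_at y k")
      case True
      then have "agree_from k x y"
        using Suc.prems unfolding agree_from_def by (metis Suc_leI le_neq_implies_less)
      then show ?thesis using Suc.IH by (meson less_SucI)
    next
      case False
      moreover have "n \<le> k"
        using Suc.prems assms(1) agree_from_mono by (metis not_less_eq_eq)
      ultimately show ?thesis using Suc.prems by blast
    qed
  qed
  then show ?thesis using that by blast
qed

lemma first_one:
  assumes "one_at x i"
  obtains m where "one_at x m" "\<And>j. j < m \<Longrightarrow> \<not> one_at x j"
  using assms exists_least_iff[of "one_at x"] by blast

lemma toggle_beyond_one:
  assumes "one_at x m"
  shows "agree_from (Suc m) x (toggle p x)"
  using assms unfolding agree_from_def one_at_toggle by (auto simp: Suc_le_eq)

text \<open>Clearing the first letters.\<close>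

definition clear :: "nat \<Rightarrow> bit stream \<Rightarrow> bit stream" where
  "clear n x = word (\<lambda>i. n \<le> i \<and> one_at x i)"

lemma one_at_clear [simp]: "one_at (clear n x) i \<longleftrightarrow> n \<le> i \<and> one_at x i"
  by (simp add: clear_def)

text \<open>Induction on \<open>n\<close>: once the letters before position \<open>n\<close> are \<open>0\<close>, the generator of the parity of \<open>n\<close>
  reaches the letter at \<open>n\<close> and turns a \<open>1\<close> there into \<open>0\<close>; the earlier letters it disturbs
  are cleared again by the induction hypothesis.\<close>

lemma linked_clear: "linked\<^sup>*\<^sup>* x (clear n x)"
proof (induction n arbitrary: x)
  case 0
  have "clear 0 x = x" by (rule word_eqI) simp
  then show ?case by simp
next
  case (Suc n)
  let ?y = "clear n x"
  show ?case
  proof (cases "one_at x n")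
    case True
    let ?z = "toggle (even n) ?y"
    have "clear n ?z = clear (Suc n) x"
    proof (rule word_eqI)
      fix i
      consider "i < n" | "i = n" | "n < i" by linarith
      then show "one_at (clear n ?z) i = one_at (clear (Suc n) x) i"
        using True by cases (auto simp: one_at_toggle)
    qed
    moreover have "linked\<^sup>*\<^sup>* ?y ?z" using linked_toggle by blast
    ultimately show ?thesis using Suc.IH[of x] Suc.IH[of ?z] by (metis rtranclp_trans)
  next
    case False
    then have "clear (Suc n) x = ?y"
      by (intro word_eqI) (auto simp: Suc_le_eq le_less)
    then show ?thesis using Suc.IH[of x] by simp
  qed
qed

lemma agree_from_linked:
  assumes "agree_from n x y"
  shows "linked\<^sup>*\<^sup>* x y"
proof -
  have "clear n x = clear n y"
    using assms by (intro word_eqI) (auto simp: agree_from_def)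
  then show ?thesis
    using linked_clear[of x n] linked_rtranclp_sym[OF linked_clear[of y n]] by simp
qed

lemma agree_from_orbit: "agree_from n x y \<Longrightarrow> y \<in> basilica_orbit x"
  using agree_from_linked unfolding basilica_orbit_linked by blast

definition zero_word :: "bit stream" where
  "zero_word = word (\<lambda>i. False)"

definition alternating :: "bool \<Rightarrow> bit stream" where
  "alternating p = word (\<lambda>i. even i = p)"

lemma one_at_zero_word [simp]: "\<not> one_at zero_word i"
  by (simp add: zero_word_def)

lemma one_at_alternating [simp]: "one_at (alternating p) i \<longleftrightarrow> even i = p"
  by (simp add: alternating_def)

lemma toggle_zero_word: "toggle p zero_word = alternating p"
  by (rule word_eqI) (simp add: one_at_toggle)

text \<open>These words form the orbit of \<open>0\<^sup>\<omega>\<close> (lemma \<open>orbit_zero_word\<close>).  It is the only orbit in which the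
  tail can change, at the vertex \<open>0\<^sup>\<omega>\<close>, which the generators send to the alternating words.\<close>

definition exceptional :: "bit stream \<Rightarrow> bool" where
  "exceptional x \<longleftrightarrow> (\<exists>n. agree_from n zero_word x \<or> (\<exists>p. agree_from n (alternating p) x))"

lemma exceptional_cong: "agree_from n x y \<Longrightarrow> exceptional x \<Longrightarrow> exceptional y"
  unfolding exceptional_def by (meson agree_from_mono agree_from_trans max.cobounded1 max.cobounded2)

lemma nonzero_has_one:
  assumes "x \<noteq> zero_word"
  shows "\<exists>m. one_at x m"
  using assms word_eqI[of x zero_word] by auto

lemma toggle_tail:
  assumes "x \<noteq> zero_word"
  shows "\<exists>n. agree_from n x (toggle p x)"
  using nonzero_has_one[OF assms] toggle_beyond_one by blast

lemma exceptional_zero_word: "exceptional zero_word" "exceptional (alternating p)"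
  unfolding exceptional_def using agree_from_refl by blast+

lemma exceptional_toggle: "exceptional (toggle p x) \<longleftrightarrow> exceptional x"
proof (cases "x = zero_word")
  case True
  then show ?thesis using exceptional_zero_word toggle_zero_word by simp
next
  case False
  then show ?thesis using toggle_tail exceptional_cong agree_from_sym by metis
qed

lemma exceptional_linked: "linked\<^sup>*\<^sup>* x y \<Longrightarrow> exceptional y \<longleftrightarrow> exceptional x"
  by (induction rule: rtranclp_induct) (auto simp: linked_def exceptional_toggle)

lemma orbit_nonexceptional:
  assumes "\<not> exceptional x"
  shows "basilica_orbit x = {y. \<exists>n. agree_from n x y}"
proof (intro equalityI subsetI)
  fix y assume "y \<in> basilica_orbit x"
  then have "linked\<^sup>*\<^sup>* x y" unfolding basilica_orbit_linked by simp
  then have "\<exists>n. agree_from n x y"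
  proof (induction rule: rtranclp_induct)
    case (step y z)
    have "\<not> exceptional y" "\<not> exceptional z"
      using step.hyps assms exceptional_linked by (blast, metis rtranclp.rtrancl_into_rtrancl)
    then have "y \<noteq> zero_word" "z \<noteq> zero_word" using exceptional_zero_word by auto
    then have "\<exists>k. agree_from k y z"
      using step.hyps(2) toggle_tail agree_from_sym unfolding linked_def by metis
    then show ?case
      using step.IH by (meson agree_from_mono agree_from_trans max.cobounded1 max.cobounded2)
  qed (use agree_from_refl in blast)
  then show "y \<in> {y. \<exists>n. agree_from n x y}" by simp
qed (auto intro: agree_from_orbit)

lemma orbit_zero_word: "basilica_orbit zero_word = {y. exceptional y}"
proof (intro equalityI subsetI)
  fix y assume "y \<in> basilica_orbit zero_word"
  then show "y \<in> {y. exceptional y}"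
    using exceptional_linked exceptional_zero_word unfolding basilica_orbit_linked by blast
next
  fix y assume "y \<in> {y. exceptional y}"
  moreover have "linked\<^sup>*\<^sup>* zero_word (alternating p)" for p
    using linked_toggle[of zero_word p] by (simp add: toggle_zero_word)
  ultimately show "y \<in> basilica_orbit zero_word"
    using agree_from_linked unfolding exceptional_def basilica_orbit_linked mem_Collect_eq
    by (meson rtranclp_trans)
qed

lemma exceptional_schreier_graph:
  assumes "exceptional x"
  shows "schreier_graph x = schreier_graph zero_word"
proof -
  have "linked\<^sup>*\<^sup>* zero_word x" "linked\<^sup>*\<^sup>* x zero_word"
    using assms orbit_zero_word linked_rtranclp_sym unfolding basilica_orbit_linked by auto
  then have "basilica_orbit x = basilica_orbit zero_word"
    unfolding basilica_orbit_linked by (auto intro: rtranclp_trans)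
  then show ?thesis by (simp add: schreier_graph_def)
qed

text \<open>The colouring principle for Schreier graphs: it is enough to check that the generators preserve colours.\<close>

lemma schreier_graph_ends:
  assumes cuts: "\<And>F. F \<in> cuts \<Longrightarrow> finite F \<and> F \<noteq> {} \<and> F \<subseteq> basilica_orbit \<xi>"
    and exhausting: "\<And>S. finite S \<Longrightarrow> S \<subseteq> basilica_orbit \<xi> \<Longrightarrow> \<exists>F\<in>cuts. S \<subseteq> F"
    and toggle: "\<And>F x p. F \<in> cuts \<Longrightarrow> x \<in> basilica_orbit \<xi> \<Longrightarrow> x \<notin> F \<Longrightarrow> toggle p x \<notin> F \<Longrightarrow>
      colour (toggle p x) = colour x"
    and gates: "\<And>F x y x' y'. F \<in> cuts \<Longrightarrow> linked x y \<Longrightarrow> x \<notin> F \<Longrightarrow> y \<in> F \<Longrightarrow>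
      linked x' y' \<Longrightarrow> x' \<notin> F \<Longrightarrow> y' \<in> F \<Longrightarrow> colour x = colour x' \<Longrightarrow>
      x' \<in> component_avoiding (schreier_graph \<xi>) F x"
    and outside: "\<And>F. F \<in> cuts \<Longrightarrow> colour ` (basilica_orbit \<xi> - F) = colours"
    and "finite colours"
  shows "finite (graph_ends (schreier_graph \<xi>)) \<and>
    card (graph_ends (schreier_graph \<xi>)) = card colours"
proof -
  let ?G = "schreier_graph \<xi>"
  have verts: "verts ?G = basilica_orbit \<xi>" by (simp add: schreier_graph_def)
  interpret coloured_cuts ?G cuts colour colours
  proof
    show "finite {y. adjacent ?G x y}" for x
      using finite_linked[of x] unfolding adjacent_schreier_graph
      by (rule rev_finite_subset) auto
    show "colour x = colour y" if "F \<in> cuts" "adjacent ?G x y" "x \<notin> F" "y \<notin> F" for F x y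
      using that toggle unfolding adjacent_schreier_graph linked_def by metis
  qed (use assms schreier_graph_component in \<open>auto simp: verts adjacent_schreier_graph\<close>)
  show ?thesis using ends_coloured by simp
qed

section \<open>Words outside the orbit of the zero word\<close>

text \<open>To change a letter at or beyond \<open>n\<close>, a generator must find only zeros before it.  As the
  letter at \<open>n\<close> is \<open>1\<close>, that one must be the letter flipped.\<close>

lemma agree_from_exit:
  assumes one: "one_at \<xi> n" and y: "agree_from n \<xi> y" and out: "\<not> agree_from n \<xi> (toggle p y)"
  shows "p = even n" and "y = clear n \<xi>"
proof -
  obtain i where i: "n \<le> i" "one_at y i \<noteq> one_at (toggle p y) i"
    using y out unfolding agree_from_def by auto
  then have par: "even i = p" and zeros: "\<And>j. j < i \<Longrightarrow> \<not> one_at y j"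
    unfolding one_at_toggle by auto
  moreover have "one_at y n" using one y by (simp add: agree_from_def)
  ultimately have "i = n" using i(1) by (metis le_neq_implies_less)
  then show "p = even n" using par by simp
  show "y = clear n \<xi>"
    using y zeros \<open>i = n\<close> by (intro word_eqI) (metis agree_from_def not_le one_at_clear)
qed

text \<open>As above, some letter at or beyond \<open>n\<close> is flipped, so \<open>x\<close> starts with zeros.  The letter
  \<open>1\<close> at \<open>n\<close> in the image can then only result from a flip, which fixes the generator; and it
  flips every position of its parity before \<open>n\<close>, which fixes the image.\<close>

lemma agree_from_entry:
  assumes one: "one_at \<xi> n" and x: "\<not> agree_from n \<xi> x" and y: "agree_from n \<xi> (toggle p x)"
  shows "p = even n" and "toggle p x = word (\<lambda>i. if i < n then even i = p else one_at \<xi> i)"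
proof -
  obtain i where i: "n \<le> i" "one_at x i \<noteq> one_at (toggle p x) i"
    using x y unfolding agree_from_def by auto
  then have par: "even i = p" and zeros: "\<And>j. j < i \<Longrightarrow> \<not> one_at x j"
    unfolding one_at_toggle by auto
  have "one_at (toggle p x) n" using one y by (simp add: agree_from_def)
  then show "p = even n"
    using par zeros i(1) by (cases "i = n") (auto simp: one_at_toggle)
  show "toggle p x = word (\<lambda>i. if i < n then even i = p else one_at \<xi> i)"
    using y zeros i(1) by (intro word_eqI) (auto simp: one_at_toggle agree_from_def)
qed

lemma agree_from_entry_unique:
  assumes one: "one_at \<xi> n"
    and x: "\<not> agree_from n \<xi> x" "agree_from n \<xi> (toggle (even n) x)"
    and y: "\<not> agree_from n \<xi> y" "agree_from n \<xi> (toggle (even n) y)"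
  shows "x = y"
  by (rule toggle_inject[OF trans[OF agree_from_entry(2)[OF one x] agree_from_entry(2)[OF one y, symmetric]]])

lemma tail_classes_exhaust:
  assumes ns: "\<not> exceptional \<xi>" and good: "\<And>k. \<exists>n\<ge>k. good n"
    and S: "finite S" "S \<subseteq> basilica_orbit \<xi>"
  shows "\<exists>F\<in>{{y. agree_from n \<xi> y} | n. good n}. S \<subseteq> F"
proof -
  have "\<forall>\<^sub>F n in sequentially. agree_from n \<xi> y" if "y \<in> S" for y
    using that S(2) agree_from_mono unfolding orbit_nonexceptional[OF ns] eventually_sequentially by blast
  then have "\<forall>\<^sub>F n in sequentially. \<forall>y\<in>S. agree_from n \<xi> y"
    using S(1) by (simp add: eventually_ball_finite)
  then obtain N where N: "\<And>n y. n \<ge> N \<Longrightarrow> y \<in> S \<Longrightarrow> agree_from n \<xi> y"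
    unfolding eventually_sequentially by blast
  obtain n where "n \<ge> N" "good n" using good by blast
  then show ?thesis using N by blast
qed

lemma tail_class_cut:
  assumes "F \<in> {{y. agree_from n \<xi> y} | n. good n}"
  shows "finite F \<and> F \<noteq> {} \<and> F \<subseteq> basilica_orbit \<xi>"
  using assms finite_agree_from agree_from_orbit agree_from_refl by blast

text \<open>A letter \<open>1\<close> at \<open>m\<close> of the other parity makes the class of words agreeing with \<open>\<xi>\<close> from \<open>m\<close> on invariant
  under the generator, by \<open>agree_from_exit\<close>.  This class is finite, so the orbit of the leaving
  vertex is a cycle.  Following it from the first gate until it returns to the cut, one stays outside
  the cut and arrives at a vertex from which the generator enters the cut; by uniqueness of the
  entry this is the second gate.\<close>

lemma toggle_cycle_bypasses:
  assumes one: "one_at \<xi> n" and later: "one_at \<xi> m" "n < m" "even m \<noteq> even n"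
    and x: "\<not> agree_from n \<xi> x" "agree_from n \<xi> (toggle (even n) x)"
    and out: "\<not> agree_from n \<xi> (toggle (even n) (clear n \<xi>))"
  shows "x \<in> component_avoiding (schreier_graph \<xi>) {y. agree_from n \<xi> y} (toggle (even n) (clear n \<xi>))"
proof -
  let ?F = "{y. agree_from n \<xi> y}" and ?t = "toggle (even n)" and ?g = "clear n \<xi>"
  have stay: "agree_from m \<xi> ((?t ^^ k) ?g)" for k
  proof (induction k)
    case 0
    show ?case using later(2) by (simp add: agree_from_def)
  next
    case (Suc k)
    then show ?case using agree_from_exit(1)[OF later(1)] later(3) by fastforce
  qed
  then have "{y. \<exists>k. y = (?t ^^ k) ?g} \<subseteq> {y. agree_from m \<xi> y}" by auto
  then have fin: "finite {y. \<exists>k. y = (?t ^^ k) ?g}"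
    by (rule finite_subset) (rule finite_agree_from)
  have "inj ?t" by (intro injI) (rule toggle_inject)
  then obtain k where k: "k > 0" "(?t ^^ k) ?g = ?g"
    using fin by (rule funpow_inj_finite)
  define P where "P j \<longleftrightarrow> j > 0 \<and> (?t ^^ j) ?g \<in> ?F" for j
  have "P k" using k unfolding P_def by (simp add: agree_from_def)
  then obtain j where j: "P j" "\<And>i. i < j \<Longrightarrow> \<not> P i"
    using exists_least_iff[of P] by blast
  have "j \<noteq> 1" using j(1) out unfolding P_def by auto
  then obtain i where i: "j = Suc i" "i > 0" using j(1) unfolding P_def by (cases j) auto
  have outside: "(?t ^^ l) ?g \<notin> ?F" if "0 < l" "l \<le> i" for l
    using j(2)[of l] that i unfolding P_def by simp
  have orbit: "(?t ^^ l) ?g \<in> basilica_orbit \<xi>" for l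
    using stay agree_from_orbit by blast
  have "(?t ^^ l) ?g \<in> component_avoiding (schreier_graph \<xi>) ?F (?t ?g)" if "1 \<le> l" "l \<le> i" for l
    using that
  proof (induction l rule: dec_induct)
    case (step l)
    have "adjacent (schreier_graph \<xi>) ((?t ^^ l) ?g) ((?t ^^ Suc l) ?g)"
      using orbit[of l] orbit[of "Suc l"] linked_toggle unfolding adjacent_schreier_graph by simp
    then have "(?t ^^ Suc l) ?g \<in> component_avoiding (schreier_graph \<xi>) ?F ((?t ^^ l) ?g)"
      using outside[of l] outside[of "Suc l"] step by (intro component_avoiding_step) auto
    then show ?case using step component_avoiding_trans by (metis Suc_leD)
  qed simp
  then have comp: "(?t ^^ i) ?g \<in> component_avoiding (schreier_graph \<xi>) ?F (?t ?g)"
    using i by simp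
  have "agree_from n \<xi> (?t ((?t ^^ i) ?g))" "\<not> agree_from n \<xi> ((?t ^^ i) ?g)"
    using j(1) i outside[of i] unfolding P_def by auto
  then have "(?t ^^ i) ?g = x" using agree_from_entry_unique[OF one] x by blast
  then show ?thesis using comp by simp
qed

text \<open>With a single colour, it only remains to connect the two gates.  The cuts are taken at all positions
  carrying a \<open>1\<close>.\<close>

theorem one_end:
  assumes inf: "\<And>p. infinite {i. even i = p \<and> one_at \<xi> i}"
  shows "finite (graph_ends (schreier_graph \<xi>)) \<and> card (graph_ends (schreier_graph \<xi>)) = 1"
proof -
  have later: "\<exists>i\<ge>k. even i = p \<and> one_at \<xi> i" for k p
    using inf[of p] unfolding infinite_nat_iff_unbounded_le by auto
  have ns: "\<not> exceptional \<xi>"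
  proof
    assume "exceptional \<xi>"
    then obtain n where "agree_from n zero_word \<xi> \<or> (\<exists>p. agree_from n (alternating p) \<xi>)"
      unfolding exceptional_def by blast
    then show False
    proof (elim disjE exE)
      assume "agree_from n zero_word \<xi>"
      then show False using later[of n True] by (auto simp: agree_from_def)
    next
      fix p assume "agree_from n (alternating p) \<xi>"
      then show False using later[of n "\<not> p"] by (auto simp: agree_from_def)
    qed
  qed
  let ?cuts = "{{y. agree_from n \<xi> y} | n. one_at \<xi> n}"
  let ?G = "schreier_graph \<xi>"
  have "finite (graph_ends ?G) \<and> card (graph_ends ?G) = card {()}"
  proof (rule schreier_graph_ends[where cuts = ?cuts and colour = "\<lambda>_. ()" and colours = "{()}"])
    show "\<exists>F\<in>?cuts. S \<subseteq> F" if "finite S" "S \<subseteq> basilica_orbit \<xi>" for S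
      by (rule tail_classes_exhaust[OF ns _ that]) (use later in blast)
  next
    fix F x y x' y'
    assume "F \<in> ?cuts" and xy: "linked x y" "x \<notin> F" "y \<in> F" and xy': "linked x' y'" "x' \<notin> F" "y' \<in> F"
    then obtain n where n: "one_at \<xi> n" and F: "F = {y. agree_from n \<xi> y}" by blast
    let ?g = "clear n \<xi>" and ?t = "toggle (even n)"
    obtain m where m: "one_at \<xi> m" "n < m" "even m \<noteq> even n"
      using later[of "Suc n" "odd n"] by (auto simp: Suc_le_eq)
    have gate: "x = ?t ?g \<or> agree_from n \<xi> (?t x)" if "linked x y" "x \<notin> F" "y \<in> F" for x y
      using that agree_from_exit[OF n] agree_from_entry[OF n] unfolding F linked_def by auto
    have bypass: "x' \<in> component_avoiding ?G F x"
      if "x = ?t ?g" "agree_from n \<xi> (?t x')" "x \<notin> F" "x' \<notin> F" for x x'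
      using toggle_cycle_bypasses[OF n m, of x'] that unfolding F by simp
    have same: "x' = x" if "agree_from n \<xi> (?t x)" "agree_from n \<xi> (?t x')" "x \<notin> F" "x' \<notin> F"
      using agree_from_entry_unique[OF n, of x' x] that unfolding F by simp
    show "x' \<in> component_avoiding ?G F x"
      using gate[OF xy] gate[OF xy'] bypass[of x x'] bypass[of x' x] same xy xy'
        component_avoiding_sym component_avoiding_refl by metis
  next
    fix F assume "F \<in> ?cuts"
    then obtain n where n: "one_at \<xi> n" and F: "F = {y. agree_from n \<xi> y}" by blast
    have "clear (Suc n) \<xi> \<in> basilica_orbit \<xi> - F"
      using n agree_from_orbit[of "Suc n" \<xi> "clear (Suc n) \<xi>"] unfolding F
      by (auto simp: agree_from_def)
    then show "(\<lambda>_. ()) ` (basilica_orbit \<xi> - F) = {()}" by blast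
  next
    show "finite F \<and> F \<noteq> {} \<and> F \<subseteq> basilica_orbit \<xi>" if "F \<in> ?cuts" for F
      by (rule tail_class_cut[OF that])
  qed auto
  then show ?thesis by simp
qed

text \<open>The colour of \<open>y\<close> is \<open>upper\<close> if at the last position \<open>d\<close> where \<open>y\<close> differs from \<open>\<xi>\<close> the word \<open>y\<close> has
  the \<open>1\<close>, and \<open>d\<close> has the parity \<open>s\<close> of the late letters \<open>1\<close> of \<open>\<xi>\<close>.  Among words vanishing at the other
  parity this is the odometer order relative to \<open>\<xi>\<close>.  The last difference between
  \<open>\<xi>\<close> and a word outside a cut can also be an extra \<open>1\<close> of the word at a position \<open>d\<close> of the other parity;
  such a word is not upper, because it lies in the finite part hanging off the line at the vertex obtained
  from \<open>\<xi>\<close> by clearing all letters up to \<open>d\<close>, and this vertex is not upper.  Each cut has one gate of either colour: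
  leaving the cut erases the \<open>1\<close> of \<open>\<xi>\<close> at \<open>n\<close>, whereas the vertex entering the cut has an
  extra \<open>1\<close> that is about to be erased.\<close>

theorem two_ends:
  assumes ns: "\<not> exceptional \<xi>" and zeros: "\<And>i. N \<le> i \<Longrightarrow> one_at \<xi> i \<Longrightarrow> even i = s"
  shows "finite (graph_ends (schreier_graph \<xi>)) \<and> card (graph_ends (schreier_graph \<xi>)) = 2"
proof -
  have later_one: "\<exists>i\<ge>k. one_at \<xi> i" for k
    using ns unfolding exceptional_def agree_from_def by auto
  have later_zero: "\<exists>i\<ge>k. even i = s \<and> \<not> one_at \<xi> i" for k
  proof (rule ccontr)
    assume "\<not> ?thesis"
    then have "agree_from (max k N) (alternating s) \<xi>"
      using zeros unfolding agree_from_def by auto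
    then show False using ns unfolding exceptional_def by blast
  qed
  define upper where "upper y \<longleftrightarrow>
    (\<exists>d. even d = s \<and> one_at y d \<and> \<not> one_at \<xi> d \<and> agree_from (Suc d) \<xi> y)" for y
  have not_upper: "\<not> upper y" if "one_at \<xi> d" "\<not> one_at y d" "agree_from (Suc d) \<xi> y" for y d
  proof
    assume "upper y"
    then obtain e where e: "one_at y e" "\<not> one_at \<xi> e" "agree_from (Suc e) \<xi> y"
      unfolding upper_def by blast
    consider "e < d" | "e = d" | "d < e" by linarith
    then show False using that e by cases (auto simp: agree_from_def)
  qed
  have nonzero: "x \<noteq> zero_word" if "agree_from k \<xi> (toggle p x)" for x p k
    using that ns exceptional_zero_word exceptional_cong exceptional_toggle agree_from_sym by metis
  \<comment> \<open>Both directions look at the first \<open>1\<close> of \<open>x\<close>, at \<open>m\<close>: nothing beyond \<open>m\<close> changes, and before \<open>m\<close> exactly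
    the positions of parity \<open>p\<close> turn into \<open>1\<close>.\<close>
  have toggle_upper: "upper (toggle p x) \<longleftrightarrow> upper x"
    if n: "N \<le> n" and out: "\<not> agree_from n \<xi> (toggle p x)" for n p x
  proof
    assume "upper x"
    then obtain d where d: "even d = s" "one_at x d" "\<not> one_at \<xi> d" "agree_from (Suc d) \<xi> x"
      unfolding upper_def by blast
    obtain m where m: "one_at x m" "\<And>j. j < m \<Longrightarrow> \<not> one_at x j" using first_one[OF d(2)] by blast
    have beyond: "agree_from (Suc m) x (toggle p x)" using toggle_beyond_one[OF m(1)] .
    have "m \<le> d" using d(2) m(2) by (meson not_le)
    then have tail: "agree_from (Suc d) \<xi> (toggle p x)"
      using d(4) beyond agree_from_mono[of "Suc m" x _ "Suc d"] agree_from_trans by blast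
    show "upper (toggle p x)"
    proof (cases "one_at (toggle p x) d")
      case True
      then show ?thesis using d tail unfolding upper_def by blast
    next
      case False
      then have p: "p = s" and below: "\<And>j. j < d \<Longrightarrow> \<not> one_at x j"
        using d(1,2) unfolding one_at_toggle by auto
      obtain e where e: "n \<le> e" "e < Suc d" "one_at \<xi> e \<noteq> one_at (toggle p x) e"
          "agree_from (Suc e) \<xi> (toggle p x)"
        using last_disagreement[OF out tail] by blast
      have "e < d" using e(2,3) False d(3) by (metis less_antisym)
      then have "one_at (toggle p x) e \<longleftrightarrow> even e = s" using below p by (auto simp: one_at_toggle)
      then show ?thesis using e zeros[of e] n unfolding upper_def by auto
    qed
  next
    assume "upper (toggle p x)"
    then obtain d where d: "even d = s" "one_at (toggle p x) d" "\<not> one_at \<xi> d"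
        "agree_from (Suc d) \<xi> (toggle p x)"
      unfolding upper_def by blast
    have "x \<noteq> zero_word" using nonzero d(4) by blast
    then obtain m where m: "one_at x m" "\<And>j. j < m \<Longrightarrow> \<not> one_at x j"
      using nonzero_has_one first_one by metis
    have beyond: "agree_from (Suc m) \<xi> x" if "d \<le> m"
      using that toggle_beyond_one[OF m(1), of p] d(4) agree_from_mono[of "Suc d" \<xi> _ "Suc m"]
        agree_from_sym agree_from_trans by (metis Suc_le_mono)
    consider "m < d" | "m = d" | "d < m" by linarith
    then show "upper x"
    proof cases
      case 1
      then have "agree_from d x (toggle p x)"
        using toggle_beyond_one[OF m(1), of p] agree_from_mono by (metis Suc_leI)
      then show ?thesis using d unfolding upper_def agree_from_def by (metis Suc_leD order_refl)
    next
      case 2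
      then show ?thesis using d m beyond unfolding upper_def by blast
    next
      case 3
      then have p: "p = s" using d(1,2) m(2) by (auto simp: one_at_toggle)
      have \<xi>m: "one_at \<xi> m = one_at (toggle p x) m" using d(4) 3 by (auto simp: agree_from_def)
      obtain i where "n \<le> i" "one_at \<xi> i \<noteq> one_at (toggle p x) i"
        using out unfolding agree_from_def by blast
      then have "N \<le> m" using n 3 d(4) unfolding agree_from_def by (metis le_trans less_imp_le not_less_eq_eq)
      then have "even m = s" using zeros \<xi>m m by (auto simp: one_at_toggle p)
      then show ?thesis using \<xi>m m p beyond 3 unfolding upper_def by (auto simp: one_at_toggle)
    qed
  qed
  let ?good = "\<lambda>n. N \<le> n \<and> one_at \<xi> n"
  let ?cuts = "{{y. agree_from n \<xi> y} | n. ?good n}"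
  let ?G = "schreier_graph \<xi>"
  have "finite (graph_ends ?G) \<and> card (graph_ends ?G) = card (UNIV :: bool set)"
  proof (rule schreier_graph_ends[where cuts = ?cuts and colour = upper and colours = UNIV])
    show "\<exists>F\<in>?cuts. S \<subseteq> F" if "finite S" "S \<subseteq> basilica_orbit \<xi>" for S
    proof (rule tail_classes_exhaust[OF ns _ that])
      show "\<exists>n\<ge>k. ?good n" for k using later_one[of "max k N"] by auto
    qed
  next
    fix F x p assume "F \<in> ?cuts" "toggle p x \<notin> F"
    then show "upper (toggle p x) = upper x" using toggle_upper by auto
  next
    fix F x y x' y'
    assume "F \<in> ?cuts" and xy: "linked x y" "x \<notin> F" "y \<in> F"
      and xy': "linked x' y'" "x' \<notin> F" "y' \<in> F" and col: "upper x = upper x'"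
    then obtain n where n: "N \<le> n" "one_at \<xi> n" and F: "F = {y. agree_from n \<xi> y}" by blast
    let ?g = "clear n \<xi>" and ?t = "toggle (even n)"
    \<comment> \<open>The first alternative is the gate reached on leaving the cut, the second the one from which it is entered.\<close>
    have gate: "x = ?t ?g \<or> agree_from n \<xi> (?t x)" if "linked x y" "x \<notin> F" "y \<in> F" for x y
      using that agree_from_exit[OF n(2)] agree_from_entry[OF n(2)] unfolding F linked_def by auto
    have exit: "\<not> upper (?t ?g)"
    proof (rule not_upper[OF n(2)])
      have one: "one_at ?g n" using n by simp
      show "\<not> one_at (?t ?g) n" using n by (simp add: one_at_toggle)
      show "agree_from (Suc n) \<xi> (?t ?g)"
        using toggle_beyond_one[OF one, of "even n"] by (simp add: agree_from_def)
    qed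
    have entry: "upper x" if x: "agree_from n \<xi> (?t x)" "x \<notin> F" for x
    proof -
      have s: "even n = s" using zeros n by blast
      have "x \<noteq> zero_word" using nonzero x(1) by blast
      then obtain m where m: "one_at x m" "\<And>j. j < m \<Longrightarrow> \<not> one_at x j"
        using nonzero_has_one first_one by metis
      have beyond: "agree_from (Suc m) x (?t x)" using toggle_beyond_one[OF m(1)] .
      have "n \<le> m"
        using x beyond agree_from_mono agree_from_trans agree_from_sym unfolding F
        by (metis mem_Collect_eq not_less_eq_eq)
      moreover have \<xi>t: "one_at \<xi> i = one_at (?t x) i" if "n \<le> i" for i
        using x(1) that by (auto simp: agree_from_def)
      ultimately have "m \<noteq> n" using n(2) m \<xi>t[of n] by (auto simp: one_at_toggle)
      have "even m = s"
        using \<xi>t[OF \<open>n \<le> m\<close>] zeros[of m] n(1) \<open>n \<le> m\<close> m s by (auto simp: one_at_toggle)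
      moreover have "\<not> one_at \<xi> m"
        using \<xi>t[OF \<open>n \<le> m\<close>] m s \<open>even m = s\<close> by (auto simp: one_at_toggle)
      moreover have "agree_from (Suc m) \<xi> x"
        using beyond x(1) \<open>n \<le> m\<close> by (auto simp: agree_from_def)
      ultimately show ?thesis using m(1) unfolding upper_def by blast
    qed
    have same: "x' = x" if "agree_from n \<xi> (?t x)" "agree_from n \<xi> (?t x')"
      using agree_from_entry_unique[OF n(2), of x' x] that xy(2) xy'(2) unfolding F by simp
    have "x' = x"
      using gate[OF xy] gate[OF xy'] exit entry[OF _ xy(2)] entry[OF _ xy'(2)] same col by metis
    then show "x' \<in> component_avoiding ?G F x" by simp
  next
    fix F assume "F \<in> ?cuts"
    then obtain n where n: "one_at \<xi> n" and F: "F = {y. agree_from n \<xi> y}" by blast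
    obtain i where i: "n \<le> i" "even i = s" "\<not> one_at \<xi> i" using later_zero by blast
    \<comment> \<open>Setting a late \<open>0\<close> of \<open>\<xi>\<close> at parity \<open>s\<close> to \<open>1\<close> gives an upper word, clearing up to \<open>n\<close> one that is not.\<close>
    let ?u = "word (\<lambda>j. one_at \<xi> j \<noteq> (j = i))" and ?l = "clear (Suc n) \<xi>"
    have "agree_from (Suc i) \<xi> ?u" "agree_from (Suc n) \<xi> ?l" by (auto simp: agree_from_def)
    then have "upper ?u" "\<not> upper ?l" "?u \<in> basilica_orbit \<xi>" "?l \<in> basilica_orbit \<xi>"
      using i not_upper[OF n, of ?l] agree_from_orbit unfolding upper_def by (auto intro!: exI[of _ i])
    moreover have "?u \<notin> F" "?l \<notin> F"
      using agree_fromD[of n \<xi> ?u i] agree_fromD[of n \<xi> ?l n] i n unfolding F by auto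
    ultimately have "True \<in> upper ` (basilica_orbit \<xi> - F)" "False \<in> upper ` (basilica_orbit \<xi> - F)"
      by (blast, blast)
    then show "upper ` (basilica_orbit \<xi> - F) = UNIV" by (auto simp: UNIV_bool)
  next
    show "finite F \<and> F \<noteq> {} \<and> F \<subseteq> basilica_orbit \<xi>" if "F \<in> ?cuts" for F
      by (rule tail_class_cut[OF that])
  qed auto
  then show ?thesis by simp
qed

section \<open>The orbit of the zero word\<close>

text \<open>Besides the words ending in \<open>0\<^sup>\<omega>\<close>, a cut must contain words with either alternating tail.  It is
  used for even \<open>n\<close> only; then the tails imposed by the second and third set both begin with \<open>1\<close>, the third
  one at \<open>n + 1\<close>, so that \<open>agree_from_exit\<close> and \<open>agree_from_entry\<close> apply to them.\<close>

definition cross_cut :: "nat \<Rightarrow> bit stream set" where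
  "cross_cut n = {y. agree_from n zero_word y} \<union> {y. agree_from n (alternating True) y}
    \<union> {y. agree_from (Suc n) (alternating False) y}"

text \<open>The half-line issuing from \<open>0\<^sup>\<omega>\<close> on which \<open>y\<close> hangs: the first component tells whether it consists of
  the forward images of \<open>0\<^sup>\<omega>\<close> under a generator (\<open>True\<close>; these have alternating tails) or of the backward
  ones, the second component which generator it is.  The value at \<open>0\<^sup>\<omega>\<close> is arbitrary, as \<open>0\<^sup>\<omega>\<close> lies in
  every cut.\<close>

definition arm :: "bit stream \<Rightarrow> bool \<times> bool" where
  "arm y = (if \<exists>n. agree_from n zero_word y
    then (False, \<exists>l. even l \<and> one_at y l \<and> agree_from (Suc l) zero_word y)
    else (True, \<exists>n. agree_from n (alternating True) y))"

lemma arm_zero_tail: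
  assumes "one_at y l" "agree_from (Suc l) zero_word y"
  shows "arm y = (False, even l)"
proof -
  have "k = l" if "one_at y k" "agree_from (Suc k) zero_word y" for k
    using that assms unfolding agree_from_def by (metis Suc_leI linorder_neqE_nat one_at_zero_word)
  then have "(\<exists>k. even k \<and> one_at y k \<and> agree_from (Suc k) zero_word y) \<longleftrightarrow> even l"
    using assms by metis
  then show ?thesis using assms(2) unfolding arm_def by auto
qed

lemma arm_alternating_tail:
  assumes "agree_from n (alternating p) y"
  shows "arm y = (True, p)"
proof -
  have "\<not> agree_from k zero_word y" for k
  proof
    assume "agree_from k zero_word y"
    then have "\<not> one_at y (2 * (n + k))" "\<not> one_at y (Suc (2 * (n + k)))"
      by (auto simp: agree_from_def)
    moreover have "one_at y (2 * (n + k)) = p" "one_at y (Suc (2 * (n + k))) = (\<not> p)"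
      using agree_fromD[OF assms] by auto
    ultimately show False by blast
  qed
  moreover have "p" if "agree_from k (alternating True) y" for k
  proof -
    have "one_at y (2 * (n + k))" using agree_fromD[OF that] by auto
    moreover have "one_at y (2 * (n + k)) = p" using agree_fromD[OF assms] by auto
    ultimately show p by simp
  qed
  ultimately show ?thesis using assms unfolding arm_def by (cases p) auto
qed

lemma zero_tail_last_one:
  assumes "agree_from k zero_word y" "y \<noteq> zero_word"
  obtains l where "one_at y l" "agree_from (Suc l) zero_word y"
proof -
  have "\<not> agree_from 0 zero_word y"
    using assms(2) word_eqI[of y zero_word] by (auto simp: agree_from_def)
  from last_disagreement[OF this assms(1)] show ?thesis using that by auto
qed

text \<open>Away from \<open>0\<^sup>\<omega>\<close> the tail is kept.  The last \<open>1\<close> of a word ending in \<open>0\<^sup>\<omega>\<close> can disappear only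
  if it is also the first one, and then the generator of its own parity has flipped it, which leaves
  ones only at positions of that parity.\<close>

lemma arm_toggle:
  assumes x: "exceptional x" "x \<noteq> zero_word" and y: "toggle p x \<noteq> zero_word"
  shows "arm (toggle p x) = arm x"
proof -
  obtain m where m: "one_at x m" "\<And>j. j < m \<Longrightarrow> \<not> one_at x j"
    using nonzero_has_one[OF x(2)] first_one by metis
  have beyond: "agree_from (Suc m) x (toggle p x)" using toggle_beyond_one[OF m(1)] .
  have ext: "agree_from (max k (Suc m)) z (toggle p x)" if "agree_from k z x" for k z
    using that beyond by (auto simp: agree_from_def)
  obtain n where "agree_from n zero_word x \<or> (\<exists>q. agree_from n (alternating q) x)"
    using x(1) unfolding exceptional_def by blast
  then show ?thesis
  proof (elim disjE exE)
    fix q assume q: "agree_from n (alternating q) x"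
    show ?thesis using arm_alternating_tail[OF q] arm_alternating_tail[OF ext[OF q]] by simp
  next
    assume z: "agree_from n zero_word x"
    obtain l where l: "one_at x l" "agree_from (Suc l) zero_word x"
      using zero_tail_last_one[OF z x(2)] .
    obtain k where k: "one_at (toggle p x) k" "agree_from (Suc k) zero_word (toggle p x)"
      using zero_tail_last_one[OF ext[OF z] y] .
    have "m \<le> l" using m(2) l(1) by (meson not_le)
    have "even k = even l"
    proof (cases "m < l")
      case True
      then have "one_at (toggle p x) l" "agree_from (Suc l) zero_word (toggle p x)"
        using beyond l by (auto simp: agree_from_def)
      then show ?thesis using arm_zero_tail k by (metis prod.inject)
    next
      case False
      then have "l = m" using \<open>m \<le> l\<close> by simp
      then have "agree_from (Suc m) zero_word (toggle p x)"
        using beyond l(2) agree_from_trans by blast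
      then have "k \<le> m" using k(1) unfolding agree_from_def by (metis not_less_eq_eq one_at_zero_word)
      show ?thesis
      proof (cases "k = m")
        case False
        then have "k < m" "even k = p" "\<not> one_at (toggle p x) m"
          using \<open>k \<le> m\<close> k m(2) by (auto simp: one_at_toggle agree_from_def)
        then show ?thesis using m \<open>l = m\<close> by (auto simp: one_at_toggle)
      qed (simp add: \<open>l = m\<close>)
    qed
    then show ?thesis using arm_zero_tail[OF l] arm_zero_tail[OF k] by simp
  qed
qed

lemma cross_cut_exceptional: "cross_cut n \<subseteq> {y. exceptional y}"
  unfolding cross_cut_def exceptional_def by blast

lemma finite_cross_cut: "finite (cross_cut n)"
  unfolding cross_cut_def by (simp add: finite_agree_from)

lemma zero_word_cross_cut: "zero_word \<in> cross_cut n"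
  unfolding cross_cut_def by simp

text \<open>A word that vanishes from \<open>n\<close> on keeps doing so, except for \<open>0\<^sup>\<omega>\<close>, whose images are alternating
  and hence in the cut as well.  So the cut can only be left from the two alternating parts, from one vertex each.\<close>

lemma cross_cut_exit:
  assumes n: "even n" and y: "y \<in> cross_cut n" and out: "toggle p y \<notin> cross_cut n"
  shows "toggle p y = toggle p (clear n (alternating True)) \<and> p
    \<or> toggle p y = toggle p (clear (Suc n) (alternating False)) \<and> \<not> p"
proof -
  have alt: "y = clear k (alternating q) \<and> p = even k"
    if "one_at (alternating q) k" "agree_from k (alternating q) y" "\<not> agree_from k (alternating q) (toggle p y)"
    for k q
    using agree_from_exit[OF that] by simp
  consider "agree_from n zero_word y" | "agree_from n (alternating True) y"
    | "agree_from (Suc n) (alternating False) y"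
    using y unfolding cross_cut_def by blast
  then show ?thesis
  proof cases
    case 1
    \<comment> \<open>From a zero tail only the zero word itself is moved far out, to an alternating word.\<close>
    have "y \<noteq> zero_word"
      using out toggle_zero_word[of p] unfolding cross_cut_def by (cases p) auto
    then obtain l where l: "one_at y l" using nonzero_has_one by blast
    then have "l < n" using 1 by (auto simp: agree_from_def not_le[symmetric])
    then have "agree_from n y (toggle p y)"
      using toggle_beyond_one[OF l] agree_from_mono by (metis Suc_leI)
    then have "agree_from n zero_word (toggle p y)" using 1 agree_from_trans by blast
    then show ?thesis using out unfolding cross_cut_def by blast
  next
    case 2
    then show ?thesis using alt[of True n] n out unfolding cross_cut_def by auto
  next
    case 3
    then show ?thesis using alt[of False "Suc n"] n out unfolding cross_cut_def by auto
  qed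
qed

text \<open>Entering one of the alternating parts, whose tail starts with a \<open>1\<close> at \<open>k\<close>, is impossible.  By
  \<open>agree_from_entry\<close> the generator would have the parity of \<open>k\<close>.  The first letter \<open>1\<close> of \<open>x\<close> would stand at
  some \<open>m \<ge> k\<close>, and the image would have the letter \<open>0\<close> at \<open>m\<close> if \<open>m\<close> has the parity of \<open>k\<close>
  and \<open>1\<close> otherwise, the opposite of the alternating word.  Entering the part ending in \<open>0\<^sup>\<omega>\<close> flips the first letter
  \<open>1\<close> to \<open>0\<close> and every letter of its parity before it to \<open>1\<close>; as these ones must lie before \<open>n\<close>, the
  flipped letter is at \<open>n\<close> or \<open>n + 1\<close>.\<close>

lemma cross_cut_entry:
  assumes n: "even n" and x: "x \<notin> cross_cut n" and y: "toggle p x \<in> cross_cut n"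
  shows "\<exists>k\<in>{n, Suc n}. p = even k \<and> toggle p x = word (\<lambda>i. i < k \<and> even i = even k)
     \<and> arm x = (False, even k)"
proof -
  have "x \<noteq> zero_word" using x zero_word_cross_cut by blast
  then obtain m where m: "one_at x m" "\<And>j. j < m \<Longrightarrow> \<not> one_at x j"
    using nonzero_has_one first_one by metis
  have beyond: "agree_from (Suc m) x (toggle p x)" using toggle_beyond_one[OF m(1)] .
  have far: "k \<le> m" if "agree_from k z (toggle p x)" "\<not> agree_from k z x" for k z
    using that beyond unfolding agree_from_def by (metis not_less_eq_eq order_trans)
  \<comment> \<open>Here \<open>alternating q\<close> with its \<open>1\<close> at \<open>k\<close> stands for either alternating part of the cut.\<close>
  have no_alt: False
    if one: "one_at (alternating q) k" and k: "agree_from k (alternating q) (toggle p x)" "\<not> agree_from k (alternating q) x"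
    for k q
  proof -
    have "p = even k" using agree_from_entry(1)[OF one k(2,1)] .
    moreover have "k \<le> m" using far k by blast
    moreover have alt: "one_at (toggle p x) i \<longleftrightarrow> even i = q" if "k \<le> i" for i
      using k(1) that by (simp add: agree_from_def)
    ultimately show False
      using one m alt[of m] by (auto simp: one_at_toggle)
  qed
  have "agree_from n zero_word (toggle p x)"
    using no_alt[of True n] no_alt[of False "Suc n"] x y n unfolding cross_cut_def by auto
  then have zero: "\<not> one_at (toggle p x) i" if "n \<le> i" for i
    using that by (simp add: agree_from_def)
  have "n \<le> m" using far[of n zero_word] \<open>agree_from n zero_word (toggle p x)\<close> x unfolding cross_cut_def by blast
  then have p: "p = even m" using zero[of m] m by (auto simp: one_at_toggle)
  have "m \<le> Suc n"
  proof (rule ccontr)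
    assume "\<not> m \<le> Suc n"
    then have "one_at (toggle p x) (m - 2)"
      using m(2) p by (auto simp: one_at_toggle)
    then show False using zero[of "m - 2"] \<open>\<not> m \<le> Suc n\<close> by simp
  qed
  then have "m \<in> {n, Suc n}" using \<open>n \<le> m\<close> by auto
  moreover have "agree_from (Suc m) zero_word x"
    using beyond zero \<open>n \<le> m\<close> by (auto simp: agree_from_def)
  moreover have "toggle p x = word (\<lambda>i. i < m \<and> even i = even m)"
  proof (rule word_eqI)
    fix i show "one_at (toggle p x) i = one_at (word (\<lambda>i. i < m \<and> even i = even m)) i"
      using zero[of i] m \<open>n \<le> m\<close> p by (cases "i < m") (auto simp: one_at_toggle)
  qed
  ultimately show ?thesis using arm_zero_tail[OF m(1)] p by blast
qed

text \<open>Each cut has exactly one gate on each of the four arms: two where it is left and two where it is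
  entered.\<close>

theorem four_ends:
  assumes "exceptional \<xi>"
  shows "finite (graph_ends (schreier_graph \<xi>)) \<and> card (graph_ends (schreier_graph \<xi>)) = 4"
  unfolding exceptional_schreier_graph[OF assms]
proof -
  let ?G = "schreier_graph zero_word" and ?cuts = "{cross_cut n | n. even n}"
  have "finite (graph_ends ?G) \<and> card (graph_ends ?G) = card (UNIV :: (bool \<times> bool) set)"
  proof (rule schreier_graph_ends[where cuts = ?cuts and colour = arm and colours = UNIV])
    show "finite F \<and> F \<noteq> {} \<and> F \<subseteq> basilica_orbit zero_word" if "F \<in> ?cuts" for F
      using that finite_cross_cut zero_word_cross_cut cross_cut_exceptional
      unfolding orbit_zero_word by blast
  next
    fix S assume S: "finite S" "S \<subseteq> basilica_orbit zero_word"
    have "\<forall>\<^sub>F n in sequentially. y \<in> cross_cut n" if y: "y \<in> S" for y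
    proof -
      obtain k where "agree_from k zero_word y \<or> (\<exists>p. agree_from k (alternating p) y)"
        using y S(2) unfolding orbit_zero_word exceptional_def by blast
      then have "agree_from k zero_word y \<or> agree_from k (alternating True) y \<or> agree_from k (alternating False) y"
        by (metis (full_types))
      then have "y \<in> cross_cut n" if "k \<le> n" for n
        using agree_from_mono[OF _ that] agree_from_mono[OF _ le_SucI[OF that]]
        unfolding cross_cut_def by blast
      then show ?thesis unfolding eventually_sequentially by blast
    qed
    then have "\<forall>\<^sub>F n in sequentially. \<forall>y\<in>S. y \<in> cross_cut n"
      using S(1) by (simp add: eventually_ball_finite)
    then obtain N where N: "\<And>n. n \<ge> N \<Longrightarrow> S \<subseteq> cross_cut n"
      unfolding eventually_sequentially by blast
    then have "S \<subseteq> cross_cut (2 * N)" by simp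
    moreover have "cross_cut (2 * N) \<in> ?cuts" by (metis (mono_tags) dvd_triv_left mem_Collect_eq)
    ultimately show "\<exists>F\<in>?cuts. S \<subseteq> F" by blast
  next
    fix F x p assume "F \<in> ?cuts" "x \<in> basilica_orbit zero_word" "x \<notin> F" "toggle p x \<notin> F"
    then show "arm (toggle p x) = arm x"
      using zero_word_cross_cut unfolding orbit_zero_word by (intro arm_toggle) auto
  next
    fix F x y x' y'
    assume "F \<in> ?cuts" and xy: "linked x y" "x \<notin> F" "y \<in> F"
      and xy': "linked x' y'" "x' \<notin> F" "y' \<in> F" and col: "arm x = arm x'"
    then obtain n where n: "even n" and F: "F = cross_cut n" by blast
    let ?t = "toggle True (clear n (alternating True))"
      and ?f = "toggle False (clear (Suc n) (alternating False))"
    have arms: "arm ?t = (True, True)" "arm ?f = (True, False)"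
    proof -
      have "one_at (clear n (alternating True)) n" using n by simp
      from toggle_beyond_one[OF this, of True] have "agree_from (Suc n) (alternating True) ?t"
        by (simp add: agree_from_def)
      then show "arm ?t = (True, True)" by (rule arm_alternating_tail)
      have "one_at (clear (Suc n) (alternating False)) (Suc n)" using n by simp
      from toggle_beyond_one[OF this, of False]
      have "agree_from (Suc (Suc n)) (alternating False) ?f"
        by (simp add: agree_from_def)
      then show "arm ?f = (True, False)" by (rule arm_alternating_tail)
    qed
    have gate: "x = ?t \<or> x = ?f \<or> (\<exists>k\<in>{n, Suc n}. arm x = (False, even k) \<and>
        toggle (even k) x = word (\<lambda>i. i < k \<and> even i = even k))"
      if xy: "linked x y" "x \<notin> F" "y \<in> F" for x y
    proof -
      obtain p where "x = toggle p y \<or> y = toggle p x" using xy(1) unfolding linked_def by blast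
      then show ?thesis
      proof
        assume "x = toggle p y"
        then show ?thesis using cross_cut_exit[OF n, of y p] xy(2,3) unfolding F by auto
      next
        assume "y = toggle p x"
        then have "\<exists>k\<in>{n, Suc n}. p = even k \<and> toggle p x = word (\<lambda>i. i < k \<and> even i = even k)
            \<and> arm x = (False, even k)"
          using cross_cut_entry[OF n] xy(2,3) unfolding F by simp
        then show ?thesis by blast
      qed
    qed
    have "x = x'"
      using gate[OF xy] gate[OF xy']
    proof (elim disjE bexE conjE)
      fix k k' assume k: "k \<in> {n, Suc n}" "k' \<in> {n, Suc n}" "arm x = (False, even k)" "arm x' = (False, even k')"
        and eq: "toggle (even k) x = word (\<lambda>i. i < k \<and> even i = even k)"
          "toggle (even k') x' = word (\<lambda>i. i < k' \<and> even i = even k')"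
      have "k = k'" using k col by auto
      then show "x = x'" using eq toggle_inject[of "even k" x x'] by simp
    qed (use col arms in auto)
    then show "x' \<in> component_avoiding ?G F x" by simp
  next
    fix F assume "F \<in> ?cuts"
    then obtain n where n: "even n" and F: "F = cross_cut n" by blast
    have "(c, q) \<in> arm ` (basilica_orbit zero_word - F)" for c q
    proof -
      \<comment> \<open>The witnesses have either a single letter \<open>1\<close>, at \<open>l\<close>, or an alternating tail that starts only
        after \<open>n + 1\<close>, where the alternating parts of the cut already require a \<open>1\<close>.\<close>
      define l where "l = (if q then n + 2 else n + 3)"
      have l: "even l = q" "n < l" "Suc n < l" using n by (auto simp: l_def)
      define x where "x = word (\<lambda>i. if c then n + 4 \<le> i \<and> even i = q else i = l)"
      have "arm x = (c, q)"
      proof (cases c)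
        case True
        then have "agree_from (n + 4) (alternating q) x" by (auto simp: agree_from_def x_def)
        from arm_alternating_tail[OF this] True show ?thesis by simp
      next
        case False
        then have "one_at x l" "agree_from (Suc l) zero_word x" by (auto simp: agree_from_def x_def)
        from arm_zero_tail[OF this] False l show ?thesis by simp
      qed
      moreover have "exceptional x"
      proof (cases c)
        case True
        then have "agree_from (n + 4) (alternating q) x" by (auto simp: agree_from_def x_def)
        then show ?thesis unfolding exceptional_def by blast
      next
        case False
        then have "agree_from (Suc l) zero_word x" by (auto simp: agree_from_def x_def)
        then show ?thesis unfolding exceptional_def by blast
      qed
      moreover have "x \<notin> F"
      proof
        have far: "one_at x (if q then n + 4 else n + 5) \<or> one_at x l"
          using n by (auto simp: x_def)
        assume "x \<in> F"
        then consider "agree_from n zero_word x" | "agree_from n (alternating True) x"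
          | "agree_from (Suc n) (alternating False) x"
          unfolding F cross_cut_def by blast
        then show False
        proof cases
          case 1
          then show ?thesis using far l by (auto simp: agree_from_def split: if_splits)
        next
          case 2
          then have "one_at x n" using n agree_fromD[of n _ x n] by simp
          then show ?thesis using l by (auto simp: x_def split: if_splits)
        next
          case 3
          then have "one_at x (Suc n)" using n agree_fromD[of "Suc n" _ x "Suc n"] by simp
          then show ?thesis using l by (auto simp: x_def split: if_splits)
        qed
      qed
      ultimately show ?thesis unfolding orbit_zero_word by (metis (mono_tags) DiffI image_eqI mem_Collect_eq)
    qed
    then show "arm ` (basilica_orbit zero_word - F) = UNIV" by auto
  qed simp
  then show "finite (graph_ends ?G) \<and> card (graph_ends ?G) = 4"
    by (simp add: card_UNIV_bool flip: UNIV_Times_UNIV)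
qed

section \<open>The classification\<close>

lemma one_at_shift: "one_at (w @- x) (length w + i) = one_at x i"
  by (simp add: one_at_def)

lemma one_at_cycle_zero: "\<not> one_at (cycle [0]) i"
proof (induction i)
  case 0
  show ?case by (simp add: one_at_def)
next
  case (Suc i)
  then show ?case by (simp add: one_at_def)
qed

lemma one_at_cycle_zero_one: "one_at (cycle [0, 1]) i = odd i"
proof (induction i rule: nat_less_induct)
  case (1 i)
  have c: "cycle [0, 1] = (0::bit) ## 1 ## cycle [0, 1]"
    using cycle_decomp[of "[0::bit, 1]"] by simp
  show ?case
  proof (cases "i < 2")
    case True
    then have "i = 0 \<or> i = 1" by auto
    then show ?thesis by (subst c) (auto simp del: cycle.simps)
  next
    case False
    then obtain j where j: "i = Suc (Suc j)" by (metis add_2_eq_Suc le_Suc_ex not_less)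
    then show ?thesis using 1 by (subst c) (simp del: cycle.simps)
  qed
qed

lemma exceptional_iff_cycles:
  "{\<xi>. exceptional \<xi>} = {w @- cycle [0] | w. True} \<union> {w @- cycle [0, 1] | w. True}"
proof (intro equalityI subsetI)
  fix x assume "x \<in> {\<xi>. exceptional \<xi>}"
  then obtain n where "agree_from n zero_word x \<or> (\<exists>p. agree_from n (alternating p) x)"
    unfolding exceptional_def by blast
  then show "x \<in> {w @- cycle [0] | w. True} \<union> {w @- cycle [0, 1] | w. True}"
  proof (elim disjE exE)
    assume "agree_from n zero_word x"
    then have "\<not> one_at x (n + i)" for i
      using agree_fromD[of n zero_word x "n + i"] by simp
    then have "\<not> one_at (sdrop n x) i" for i
      by (simp add: one_at_def sdrop_snth)
    then have "sdrop n x = cycle [0]"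
      using one_at_cycle_zero by (intro word_eqI) simp
    then have "x = stake n x @- cycle [0]" by (metis stake_sdrop)
    then show ?thesis by blast
  next
    fix p assume p: "agree_from n (alternating p) x"
    \<comment> \<open>The cycle starts with \<open>0\<close>, so one more letter goes into \<open>w\<close> if the tail from \<open>n\<close> starts with \<open>1\<close>.\<close>
    define k where "k = (if even n = p then Suc n else n)"
    have "one_at (sdrop k x) i = one_at (cycle [0, 1]) i" for i
    proof -
      have "one_at (sdrop k x) i = one_at x (k + i)" by (simp add: one_at_def sdrop_snth)
      also have "\<dots> = odd i" using agree_fromD[OF p, of "k + i"] by (auto simp: k_def split: if_splits)
      finally show ?thesis by (simp add: one_at_cycle_zero_one)
    qed
    then have "sdrop k x = cycle [0, 1]" by (rule word_eqI)
    then have "x = stake k x @- cycle [0, 1]" by (metis stake_sdrop)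
    then show ?thesis by blast
  qed
next
  fix x :: "bit stream"
  assume "x \<in> {w @- cycle [0] | w. True} \<union> {w @- cycle [0, 1] | w. True}"
  then obtain w where "x = w @- cycle [0] \<or> x = w @- cycle [0, 1]" by blast
  then have "agree_from (length w) zero_word x \<or> agree_from (length w) (alternating (odd (length w))) x"
  proof
    assume x: "x = w @- cycle [0]"
    have "\<not> one_at x i" if "length w \<le> i" for i
      using that one_at_shift[of w _ "i - length w"] unfolding x by (simp add: one_at_cycle_zero)
    then show ?thesis by (simp add: agree_from_def)
  next
    assume x: "x = w @- cycle [0, 1]"
    have "one_at x i = odd (i - length w)" if "length w \<le> i" for i
      using that one_at_shift[of w _ "i - length w"] unfolding x by (simp add: one_at_cycle_zero_one)
    then show ?thesis by (auto simp: agree_from_def)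
  qed
  then show "x \<in> {\<xi>. exceptional \<xi>}" unfolding exceptional_def by blast
qed

lemma interleaved_iff:
  "\<xi> \<in> {sinterleave \<alpha> \<beta> | \<alpha> \<beta>. infinite {i. \<alpha> !! i = 1} \<and> infinite {j. \<beta> !! j = 1}} \<longleftrightarrow>
    (\<forall>p. infinite {i. even i = p \<and> one_at \<xi> i})"
proof -
  have ev: "{i. even i = True \<and> one_at \<xi> i} = (\<lambda>i. 2 * i) ` {i. \<xi> !! (2 * i) = 1}"
    by (auto simp: one_at_def elim!: evenE)
  have od: "{i. even i = False \<and> one_at \<xi> i} = (\<lambda>i. 2 * i + 1) ` {i. \<xi> !! (2 * i + 1) = 1}"
    by (auto simp: one_at_def elim!: oddE)
  have "infinite {i. even i = True \<and> one_at \<xi> i} \<longleftrightarrow> infinite {i. \<xi> !! (2 * i) = 1}"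
    "infinite {i. even i = False \<and> one_at \<xi> i} \<longleftrightarrow> infinite {i. \<xi> !! (2 * i + 1) = 1}"
    unfolding ev od by (auto simp: finite_image_iff inj_on_def)
  then have iff: "(\<forall>p. infinite {i. even i = p \<and> one_at \<xi> i}) \<longleftrightarrow>
      infinite {i. \<xi> !! (2 * i) = 1} \<and> infinite {i. \<xi> !! (2 * i + 1) = 1}"
    by (simp only: all_bool_eq)
  have split: "\<xi> = sinterleave (smap (\<lambda>i. \<xi> !! (2 * i)) nats) (smap (\<lambda>i. \<xi> !! (2 * i + 1)) nats)"
  proof (rule word_eqI)
    fix i
    show "one_at \<xi> i = one_at (sinterleave (smap (\<lambda>i. \<xi> !! (2 * i)) nats) (smap (\<lambda>i. \<xi> !! (2 * i + 1)) nats)) i"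
      by (cases "even i") (auto simp: one_at_def elim!: oddE)
  qed
  show ?thesis
    unfolding iff
  proof
    assume "infinite {i. \<xi> !! (2 * i) = 1} \<and> infinite {i. \<xi> !! (2 * i + 1) = 1}"
    then show "\<xi> \<in> {sinterleave \<alpha> \<beta> | \<alpha> \<beta>. infinite {i. \<alpha> !! i = 1} \<and> infinite {j. \<beta> !! j = 1}}"
      using split by (auto intro!: exI simp: snth_smap)
  qed auto
qed

theorem theorem4p1:
  shows "E 4 = {w @- cycle [0] | w. True} \<union> {w @- cycle [0, 1] | w. True}
    \<and> E 1 = {sinterleave \<alpha> \<beta> | \<alpha> \<beta>. infinite {i. \<alpha> !! i = 1} \<and> infinite {j. \<beta> !! j = 1}}
    \<and> E 1 \<inter> E 4 = {} \<and> E 2 = UNIV - (E 1 \<union> E 4)"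
proof -
  define many where "many \<xi> \<longleftrightarrow> (\<forall>p. infinite {i. even i = p \<and> one_at \<xi> i})" for \<xi>
  have one: "\<xi> \<in> E k \<longleftrightarrow> k = 1" if "many \<xi>" for \<xi> k
    using one_end[of \<xi>] that unfolding E_def many_def by auto
  have four: "\<xi> \<in> E k \<longleftrightarrow> k = 4" if "exceptional \<xi>" for \<xi> k
    using four_ends[OF that] unfolding E_def by auto
  have two: "\<xi> \<in> E k \<longleftrightarrow> k = 2" if ns: "\<not> exceptional \<xi>" and few: "\<not> many \<xi>" for \<xi> k
  proof -
    obtain p where "finite {i. even i = p \<and> one_at \<xi> i}" using few unfolding many_def by blast
    then obtain N where "\<forall>i\<in>{i. even i = p \<and> one_at \<xi> i}. i < N"
      using finite_nat_set_iff_bounded by blast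
    then have "even i = (\<not> p)" if "N \<le> i" "one_at \<xi> i" for i using that by force
    then show ?thesis using two_ends[OF ns, of N "\<not> p"] unfolding E_def by auto
  qed
  have disjoint: "\<not> (exceptional \<xi> \<and> many \<xi>)" for \<xi>
    using one[of \<xi> 1] four[of \<xi> 1] by auto
  have "\<xi> \<in> E 4 \<longleftrightarrow> exceptional \<xi>" "\<xi> \<in> E 1 \<longleftrightarrow> many \<xi>"
    "\<xi> \<in> E 2 \<longleftrightarrow> \<not> exceptional \<xi> \<and> \<not> many \<xi>" for \<xi>
    using one[of \<xi>] two[of \<xi>] four[of \<xi>] disjoint[of \<xi>]
    by (cases "exceptional \<xi>"; cases "many \<xi>"; simp)+
  then have "E 4 = {\<xi>. exceptional \<xi>}" "E 1 = {\<xi>. many \<xi>}"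
    "E 2 = UNIV - (E 1 \<union> E 4)" "E 1 \<inter> E 4 = {}"
    using disjoint by blast+
  moreover have "{\<xi>. many \<xi>} =
      {sinterleave \<alpha> \<beta> | \<alpha> \<beta>. infinite {i. \<alpha> !! i = 1} \<and> infinite {j. \<beta> !! j = 1}}"
    (is "?A = ?B")
  proof (rule Set.set_eqI)
    show "\<xi> \<in> ?A \<longleftrightarrow> \<xi> \<in> ?B" for \<xi>
      unfolding interleaved_iff by (simp add: many_def)
  qed
  ultimately show ?thesis using exceptional_iff_cycles by simp
qed

end
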